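(* Let $(M,J,g,\tilde g)$ be a $2n$-dimensional almost skew-Hermitian manifold with Levi-Civita connection $\nabla$ of $g$, let $H=(J_1,J_2,J_3)$ be the almost hypercomplex structure on $TM$ and let $\hat g$ be the Sasaki metric on $TM$ (both defined in the context). Then $(TM,H,\hat g)$ is an almost hypercomplex pseudo-Hermitian manifold: $\hat g$ is a pseudo-Riemannian metric of signature $(2n,2n)$ on the $4n$-dimensional manifold $TM$ and $$\hat g(\cdot,\cdot)=\hat g(J_1\cdot,J_1\cdot)=-\hat g(J_2\cdot,J_2\cdot)=-\hat g(J_3\cdot,J_3\cdot).$$
   Context: An almost skew-Hermitian manifold $(M^{2n},J,g,\tilde g)$ is a smooth $2n$-manifold with an almost complex structure $J$ and a pseudo-Riemannian metric $g$ of signature $(n,n)$ with $g(JX,JY)=-g(X,Y)$; $\tilde g=g(\cdot,J\cdot)$ is the associated metric. $\nabla$ is the Levi-Civita connection of $g$. Lifts: local coordinates $(x^i)$ on $M$ induce coordinates $(x^i,y^i)$ on $TM$, where $(y^i)$ are the components of a tangent vector with respect to $\partial/\partial x^i$. For a vector field $X=X^k\,\partial/\partial x^k$ on $M$, the vertical lift is $X^V=X^k\,\partial/\partial y^k$ and the horizontal lift is $X^H=X^k\,\partial/\partial x^k-y^i\Gamma_{ij}^kX^j\,\partial/\partial y^k$, where $\Gamma_{ij}^k$ are the components of $\nabla$. At each point $u\in TM$ the horizontal and vertical lifts span complementary subspaces of $T_u(TM)$. The structure $H=(J_1,J_2,J_3)$ on $TM$: $J_1X^H=X^V$, $J_1X^V=-X^H$;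 $J_2X^H=(JX)^V$, $J_2X^V=(JX)^H$; $J_3=J_1\circ J_2$. An almost hypercomplex structure is a triple of anticommuting almost complex structures with $J_3=J_1\circ J_2$. The Sasaki metric $\hat g$ on $TM$: $\hat g(X^H,Y^H)=\hat g(X^V,Y^V)=g(X,Y)$, $\hat g(X^H,Y^V)=0$. *)

theory Defs
  imports "HOL-Analysis.Analysis" "HOL-Library.Function_Algebras"
begin

text \<open>Functions into a real vector space form a real vector space pointwise; tangent vectors below
  are such functions, so that tangent spaces are subspaces in the sense of the library.\<close>

instantiation "fun" :: (type, real_vector) real_vector
begin

definition scaleR_fun :: "real \<Rightarrow> ('a \<Rightarrow> 'b) \<Rightarrow> 'a \<Rightarrow> 'b" where
  "scaleR_fun r f = (\<lambda>x. r *\<^sub>R f x)"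

instance
  by standard (auto simp: scaleR_fun_def fun_eq_iff scaleR_add_right scaleR_add_left)

end

subsection \<open>Smooth maps between Euclidean spaces\<close>

text \<open>Both notions are meant for open \<open>S\<close> only.\<close>

fun Ck_on :: "nat \<Rightarrow> 'e::euclidean_space set \<Rightarrow> ('e \<Rightarrow> 'f::real_normed_vector) \<Rightarrow> bool" where
  "Ck_on 0 S f \<longleftrightarrow> continuous_on S f"
| "Ck_on (Suc k) S f \<longleftrightarrow>
     (\<forall>x\<in>S. f differentiable (at x)) \<and> (\<forall>v. Ck_on k S (\<lambda>x. frechet_derivative f (at x) v))"

definition smooth_on :: "'e::euclidean_space set \<Rightarrow> ('e \<Rightarrow> 'f::real_normed_vector) \<Rightarrow> bool" where
  "smooth_on S f \<longleftrightarrow> (\<forall>k. Ck_on k S f)"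

subsection \<open>Smooth manifolds\<close>

text \<open>A manifold is given by a topology and an atlas indexed by \<open>charts\<close>. The atlas is arbitrary, in
  particular it may be the maximal one. The values of \<open>cmap i\<close> outside \<open>cdom i\<close> are irrelevant.\<close>

record ('a, 'i, 'e) mfd =
  mtop :: "'a topology"
  charts :: "'i set"
  cdom :: "'i \<Rightarrow> 'a set"
  cmap :: "'i \<Rightarrow> 'a \<Rightarrow> 'e"

definition chart_at :: "('a, 'i, 'e) mfd \<Rightarrow> 'i \<Rightarrow> 'a \<Rightarrow> bool" where
  "chart_at M i p \<longleftrightarrow> i \<in> charts M \<and> p \<in> cdom M i"

definition cinv :: "('a, 'i, 'e) mfd \<Rightarrow> 'i \<Rightarrow> 'e \<Rightarrow> 'a" where
  "cinv M i = inv_into (cdom M i) (cmap M i)"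

definition transition :: "('a, 'i, 'e) mfd \<Rightarrow> 'i \<Rightarrow> 'i \<Rightarrow> 'e \<Rightarrow> 'e" where
  "transition M i j = cmap M j \<circ> cinv M i"

definition smooth_manifold :: "('a, 'i, 'e::euclidean_space) mfd \<Rightarrow> nat \<Rightarrow> bool" where
  "smooth_manifold M d \<longleftrightarrow>
     DIM('e) = d \<and>
     Hausdorff_space (mtop M) \<and> second_countable (mtop M) \<and>
     (\<Union>i\<in>charts M. cdom M i) = topspace (mtop M) \<and>
     (\<forall>i\<in>charts M. openin (mtop M) (cdom M i) \<and> open (cmap M i ` cdom M i) \<and>
        homeomorphic_map (subtopology (mtop M) (cdom M i)) (top_of_set (cmap M i ` cdom M i)) (cmap M i)) \<and>
     (\<forall>i\<in>charts M. \<forall>j\<in>charts M. smooth_on (cmap M i ` (cdom M i \<inter> cdom M j)) (transition M i j))"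

subsection \<open>Tangent vectors and tensor fields\<close>

text \<open>A tangent vector at \<open>p\<close> is the family of its components in all charts around \<open>p\<close> (padded with
  0 at the other indices), subject to the usual transformation law.\<close>

definition tangent_space :: "('a, 'i, 'e::euclidean_space) mfd \<Rightarrow> 'a \<Rightarrow> ('i \<Rightarrow> 'e) set" where
  "tangent_space M p = {v.
     (\<forall>i. \<not> chart_at M i p \<longrightarrow> v i = 0) \<and>
     (\<forall>i j. chart_at M i p \<longrightarrow> chart_at M j p \<longrightarrow>
        v j = frechet_derivative (transition M i j) (at (cmap M i p)) (v i))}"

text \<open>\<open>coord_vec M i a p\<close> is the tangent vector at \<open>p\<close> whose components in the chart \<open>i\<close> are \<open>a\<close>; for
  \<open>a\<close> in \<open>Basis\<close> it is the coordinate vector field of the coordinate \<open>\<lambda>q. cmap M i q \<bullet> a\<close>.\<close>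

definition coord_vec :: "('a, 'i, 'e::euclidean_space) mfd \<Rightarrow> 'i \<Rightarrow> 'e \<Rightarrow> 'a \<Rightarrow> 'i \<Rightarrow> 'e" where
  "coord_vec M i a p = (\<lambda>j. if chart_at M j p
     then frechet_derivative (transition M i j) (at (cmap M i p)) a else 0)"

definition smooth_fun :: "('a, 'i, 'e::euclidean_space) mfd \<Rightarrow> 'a set \<Rightarrow> ('a \<Rightarrow> real) \<Rightarrow> bool" where
  "smooth_fun M U f \<longleftrightarrow> (\<forall>i\<in>charts M. smooth_on (cmap M i ` (U \<inter> cdom M i)) (f \<circ> cinv M i))"

definition vector_fields :: "('a, 'i, 'e::euclidean_space) mfd \<Rightarrow> 'a set \<Rightarrow> ('a \<Rightarrow> 'i \<Rightarrow> 'e) set" where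
  "vector_fields M U = {X. (\<forall>p\<in>U. X p \<in> tangent_space M p) \<and>
     (\<forall>i\<in>charts M. smooth_on (cmap M i ` (U \<inter> cdom M i)) (\<lambda>x. X (cinv M i x) i))}"

definition smooth_endomorphism ::
  "('a, 'i, 'e::euclidean_space) mfd \<Rightarrow> ('a \<Rightarrow> ('i \<Rightarrow> 'e) \<Rightarrow> 'i \<Rightarrow> 'e) \<Rightarrow> bool" where
  "smooth_endomorphism M J \<longleftrightarrow>
     (\<forall>p\<in>topspace (mtop M). \<forall>v\<in>tangent_space M p.
        J p v \<in> tangent_space M p \<and>
        (\<forall>w\<in>tangent_space M p. J p (v + w) = J p v + J p w) \<and>
        (\<forall>r. J p (r *\<^sub>R v) = r *\<^sub>R J p v)) \<and>
     (\<forall>i\<in>charts M. \<forall>a\<in>Basis. smooth_on (cmap M i ` cdom M i)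
        (\<lambda>x. J (cinv M i x) (coord_vec M i a (cinv M i x)) i))"

definition almost_complex ::
  "('a, 'i, 'e::euclidean_space) mfd \<Rightarrow> ('a \<Rightarrow> ('i \<Rightarrow> 'e) \<Rightarrow> 'i \<Rightarrow> 'e) \<Rightarrow> bool" where
  "almost_complex M J \<longleftrightarrow> smooth_endomorphism M J \<and>
     (\<forall>p\<in>topspace (mtop M). \<forall>v\<in>tangent_space M p. J p (J p v) = - v)"

definition almost_hypercomplex ::
  "('a, 'i, 'e::euclidean_space) mfd \<Rightarrow> ('a \<Rightarrow> ('i \<Rightarrow> 'e) \<Rightarrow> 'i \<Rightarrow> 'e) \<Rightarrow>
   ('a \<Rightarrow> ('i \<Rightarrow> 'e) \<Rightarrow> 'i \<Rightarrow> 'e) \<Rightarrow> ('a \<Rightarrow> ('i \<Rightarrow> 'e) \<Rightarrow> 'i \<Rightarrow> 'e) \<Rightarrow> bool" where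
  "almost_hypercomplex M J1 J2 J3 \<longleftrightarrow>
     almost_complex M J1 \<and> almost_complex M J2 \<and> almost_complex M J3 \<and>
     (\<forall>p\<in>topspace (mtop M). \<forall>v\<in>tangent_space M p.
        J1 p (J2 p v) = - J2 p (J1 p v) \<and>
        J2 p (J3 p v) = - J3 p (J2 p v) \<and>
        J3 p (J1 p v) = - J1 p (J3 p v) \<and>
        J3 p v = J1 p (J2 p v))"

subsection \<open>Pseudo-Riemannian metrics\<close>

definition has_signature :: "'v::real_vector set \<Rightarrow> ('v \<Rightarrow> 'v \<Rightarrow> real) \<Rightarrow> nat \<Rightarrow> nat \<Rightarrow> bool" where
  "has_signature V b p q \<longleftrightarrow>
     (\<exists>P N. finite P \<and> finite N \<and> P \<inter> N = {} \<and> card P = p \<and> card N = q \<and>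
        independent (P \<union> N) \<and> span (P \<union> N) = V \<and>
        (\<forall>v\<in>P \<union> N. \<forall>w\<in>P \<union> N. v \<noteq> w \<longrightarrow> b v w = 0) \<and>
        (\<forall>v\<in>P. b v v > 0) \<and> (\<forall>v\<in>N. b v v < 0))"

definition pseudo_riemannian ::
  "('a, 'i, 'e::euclidean_space) mfd \<Rightarrow> ('a \<Rightarrow> ('i \<Rightarrow> 'e) \<Rightarrow> ('i \<Rightarrow> 'e) \<Rightarrow> real) \<Rightarrow> nat \<Rightarrow> nat \<Rightarrow> bool" where
  "pseudo_riemannian M g r s \<longleftrightarrow>
     (\<forall>p\<in>topspace (mtop M).
        (\<forall>u\<in>tangent_space M p. \<forall>v\<in>tangent_space M p.
           g p u v = g p v u \<and>
           (\<forall>w\<in>tangent_space M p. g p (u + w) v = g p u v + g p w v) \<and>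
           (\<forall>c. g p (c *\<^sub>R u) v = c * g p u v)) \<and>
        (\<forall>u\<in>tangent_space M p. (\<forall>v\<in>tangent_space M p. g p u v = 0) \<longrightarrow> u = 0) \<and>
        has_signature (tangent_space M p) (g p) r s) \<and>
     (\<forall>i\<in>charts M. \<forall>a\<in>Basis. \<forall>b\<in>Basis. smooth_on (cmap M i ` cdom M i)
        (\<lambda>x. g (cinv M i x) (coord_vec M i a (cinv M i x)) (coord_vec M i b (cinv M i x))))"

definition almost_skew_hermitian ::
  "('a, 'i, 'e::euclidean_space) mfd \<Rightarrow> nat \<Rightarrow> ('a \<Rightarrow> ('i \<Rightarrow> 'e) \<Rightarrow> 'i \<Rightarrow> 'e) \<Rightarrow>
   ('a \<Rightarrow> ('i \<Rightarrow> 'e) \<Rightarrow> ('i \<Rightarrow> 'e) \<Rightarrow> real) \<Rightarrow> ('a \<Rightarrow> ('i \<Rightarrow> 'e) \<Rightarrow> ('i \<Rightarrow> 'e) \<Rightarrow> real) \<Rightarrow> bool" where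
  "almost_skew_hermitian M n J g g' \<longleftrightarrow>
     smooth_manifold M (2 * n) \<and> almost_complex M J \<and> pseudo_riemannian M g n n \<and>
     (\<forall>p\<in>topspace (mtop M). \<forall>u\<in>tangent_space M p. \<forall>v\<in>tangent_space M p.
        g p (J p u) (J p v) = - g p u v \<and> g' p u v = g p u (J p v))"

subsection \<open>The Levi-Civita connection\<close>

text \<open>The value of \<open>dir_deriv\<close> is independent of the chosen chart around \<open>p\<close>.\<close>

definition dir_deriv :: "('a, 'i, 'e::euclidean_space) mfd \<Rightarrow> ('a \<Rightarrow> real) \<Rightarrow> 'a \<Rightarrow> ('i \<Rightarrow> 'e) \<Rightarrow> real" where
  "dir_deriv M f p v =
     (let i = (SOME i. chart_at M i p) in frechet_derivative (f \<circ> cinv M i) (at (cmap M i p)) (v i))"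

definition lie_bracket ::
  "('a, 'i, 'e::euclidean_space) mfd \<Rightarrow> ('a \<Rightarrow> 'i \<Rightarrow> 'e) \<Rightarrow> ('a \<Rightarrow> 'i \<Rightarrow> 'e) \<Rightarrow> 'a \<Rightarrow> 'i \<Rightarrow> 'e" where
  "lie_bracket M X Y p = (\<lambda>i. if chart_at M i p
     then frechet_derivative (\<lambda>x. Y (cinv M i x) i) (at (cmap M i p)) (X p i)
        - frechet_derivative (\<lambda>x. X (cinv M i x) i) (at (cmap M i p)) (Y p i)
     else 0)"

text \<open>An affine connection is taken as a family of operators \<open>nab U\<close> on the smooth vector fields over
  the open sets \<open>U\<close>, compatible with restriction. The operator on global fields determines the
  family by locality; having the local operators makes the components of the connection in a chart
  directly expressible.\<close>

definition affine_connection ::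
  "('a, 'i, 'e::euclidean_space) mfd \<Rightarrow>
   ('a set \<Rightarrow> ('a \<Rightarrow> 'i \<Rightarrow> 'e) \<Rightarrow> ('a \<Rightarrow> 'i \<Rightarrow> 'e) \<Rightarrow> 'a \<Rightarrow> 'i \<Rightarrow> 'e) \<Rightarrow> bool" where
  "affine_connection M nab \<longleftrightarrow>
     (\<forall>U. openin (mtop M) U \<longrightarrow> (\<forall>X\<in>vector_fields M U. \<forall>Y\<in>vector_fields M U.
        nab U X Y \<in> vector_fields M U \<and>
        (\<forall>Z\<in>vector_fields M U. \<forall>p\<in>U.
           nab U (\<lambda>q. X q + Z q) Y p = nab U X Y p + nab U Z Y p \<and>
           nab U X (\<lambda>q. Y q + Z q) p = nab U X Y p + nab U X Z p) \<and>
        (\<forall>f. smooth_fun M U f \<longrightarrow> (\<forall>p\<in>U.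
           nab U (\<lambda>q. f q *\<^sub>R X q) Y p = f p *\<^sub>R nab U X Y p \<and>
           nab U X (\<lambda>q. f q *\<^sub>R Y q) p = dir_deriv M f p (X p) *\<^sub>R Y p + f p *\<^sub>R nab U X Y p)))) \<and>
     (\<forall>U V. openin (mtop M) U \<longrightarrow> openin (mtop M) V \<longrightarrow> V \<subseteq> U \<longrightarrow>
        (\<forall>X\<in>vector_fields M U. \<forall>Y\<in>vector_fields M U.
         \<forall>X'\<in>vector_fields M V. \<forall>Y'\<in>vector_fields M V.
           (\<forall>p\<in>V. X' p = X p \<and> Y' p = Y p) \<longrightarrow> (\<forall>p\<in>V. nab V X' Y' p = nab U X Y p)))"

definition levi_civita ::
  "('a, 'i, 'e::euclidean_space) mfd \<Rightarrow> ('a \<Rightarrow> ('i \<Rightarrow> 'e) \<Rightarrow> ('i \<Rightarrow> 'e) \<Rightarrow> real) \<Rightarrow>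
   ('a set \<Rightarrow> ('a \<Rightarrow> 'i \<Rightarrow> 'e) \<Rightarrow> ('a \<Rightarrow> 'i \<Rightarrow> 'e) \<Rightarrow> 'a \<Rightarrow> 'i \<Rightarrow> 'e) \<Rightarrow> bool" where
  "levi_civita M g nab \<longleftrightarrow> affine_connection M nab \<and>
     (\<forall>U. openin (mtop M) U \<longrightarrow> (\<forall>X\<in>vector_fields M U. \<forall>Y\<in>vector_fields M U. \<forall>p\<in>U.
        nab U X Y p - nab U Y X p = lie_bracket M X Y p \<and>
        (\<forall>Z\<in>vector_fields M U.
           dir_deriv M (\<lambda>q. g q (Y q) (Z q)) p (X p) =
             g p (nab U X Y p) (Z p) + g p (Y p) (nab U X Z p))))"

text \<open>\<open>christoffel M nab i p a b k\<close> is the component along \<open>k\<close> of the covariant derivative, in the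
  direction of the \<open>a\<close>-th coordinate field, of the \<open>b\<close>-th one.\<close>

definition christoffel ::
  "('a, 'i, 'e::euclidean_space) mfd \<Rightarrow>
   ('a set \<Rightarrow> ('a \<Rightarrow> 'i \<Rightarrow> 'e) \<Rightarrow> ('a \<Rightarrow> 'i \<Rightarrow> 'e) \<Rightarrow> 'a \<Rightarrow> 'i \<Rightarrow> 'e) \<Rightarrow> 'i \<Rightarrow> 'a \<Rightarrow> 'e \<Rightarrow> 'e \<Rightarrow> 'e \<Rightarrow> real" where
  "christoffel M nab i p a b k = nab (cdom M i) (coord_vec M i a) (coord_vec M i b) p i \<bullet> k"

subsection \<open>The tangent bundle and its structures\<close>

text \<open>Each chart of \<open>M\<close> with coordinates \<open>x\<close> induces the chart with coordinates \<open>(x, y)\<close>, where \<open>y\<close>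
  are the components of the tangent vector. Both charts carry the same index.\<close>

definition tangent_bundle ::
  "('a, 'i, 'e::euclidean_space) mfd \<Rightarrow> ('a \<times> ('i \<Rightarrow> 'e), 'i, 'e \<times> 'e) mfd" where
  "tangent_bundle M = \<lparr>
     mtop = topology_generated_by
       {W. \<exists>i\<in>charts M. \<exists>S. open S \<and>
          W = {(p, y). p \<in> cdom M i \<and> y \<in> tangent_space M p \<and> (cmap M i p, y i) \<in> S}},
     charts = charts M,
     cdom = (\<lambda>i. {(p, y). p \<in> cdom M i \<and> y \<in> tangent_space M p}),
     cmap = (\<lambda>i (p, y). (cmap M i p, y i))\<rparr>"

text \<open>The lifts to the point \<open>u = (p, y)\<close> of a tangent vector \<open>X\<close> at \<open>p\<close>. In an induced chart the
  first component is the part along the \<open>x\<close>-coordinates, the second the part along the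
  \<open>y\<close>-coordinates.\<close>

definition vlift :: "('a \<times> ('i \<Rightarrow> 'e::euclidean_space)) \<Rightarrow> ('i \<Rightarrow> 'e) \<Rightarrow> 'i \<Rightarrow> 'e \<times> 'e" where
  "vlift u X = (\<lambda>i. (0, X i))"

definition hlift ::
  "('a, 'i, 'e::euclidean_space) mfd \<Rightarrow>
   ('a set \<Rightarrow> ('a \<Rightarrow> 'i \<Rightarrow> 'e) \<Rightarrow> ('a \<Rightarrow> 'i \<Rightarrow> 'e) \<Rightarrow> 'a \<Rightarrow> 'i \<Rightarrow> 'e) \<Rightarrow>
   ('a \<times> ('i \<Rightarrow> 'e)) \<Rightarrow> ('i \<Rightarrow> 'e) \<Rightarrow> 'i \<Rightarrow> 'e \<times> 'e" where
  "hlift M nab u X = (\<lambda>i. if chart_at M i (fst u)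
     then (X i, - (\<Sum>k\<in>Basis. (\<Sum>a\<in>Basis. \<Sum>b\<in>Basis.
             (snd u i \<bullet> a) * christoffel M nab i (fst u) a b k * (X i \<bullet> b)) *\<^sub>R k))
     else 0)"

text \<open>The unique pair \<open>(X, Y)\<close> of tangent vectors at the base point with \<open>\<xi> = X\<^sup>H + Y\<^sup>V\<close>. The tensor
  fields below are the linear (bilinear) extensions of their values on lifts.\<close>

definition hv_parts ::
  "('a, 'i, 'e::euclidean_space) mfd \<Rightarrow>
   ('a set \<Rightarrow> ('a \<Rightarrow> 'i \<Rightarrow> 'e) \<Rightarrow> ('a \<Rightarrow> 'i \<Rightarrow> 'e) \<Rightarrow> 'a \<Rightarrow> 'i \<Rightarrow> 'e) \<Rightarrow>
   ('a \<times> ('i \<Rightarrow> 'e)) \<Rightarrow> ('i \<Rightarrow> 'e \<times> 'e) \<Rightarrow> ('i \<Rightarrow> 'e) \<times> ('i \<Rightarrow> 'e)" where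
  "hv_parts M nab u \<xi> = (THE XY.
     fst XY \<in> tangent_space M (fst u) \<and> snd XY \<in> tangent_space M (fst u) \<and>
     \<xi> = hlift M nab u (fst XY) + vlift u (snd XY))"

definition lift_J1 ::
  "('a, 'i, 'e::euclidean_space) mfd \<Rightarrow>
   ('a set \<Rightarrow> ('a \<Rightarrow> 'i \<Rightarrow> 'e) \<Rightarrow> ('a \<Rightarrow> 'i \<Rightarrow> 'e) \<Rightarrow> 'a \<Rightarrow> 'i \<Rightarrow> 'e) \<Rightarrow>
   ('a \<times> ('i \<Rightarrow> 'e)) \<Rightarrow> ('i \<Rightarrow> 'e \<times> 'e) \<Rightarrow> 'i \<Rightarrow> 'e \<times> 'e" where
  "lift_J1 M nab u \<xi> = (let (X, Y) = hv_parts M nab u \<xi> in vlift u X - hlift M nab u Y)"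

definition lift_J2 ::
  "('a, 'i, 'e::euclidean_space) mfd \<Rightarrow>
   ('a set \<Rightarrow> ('a \<Rightarrow> 'i \<Rightarrow> 'e) \<Rightarrow> ('a \<Rightarrow> 'i \<Rightarrow> 'e) \<Rightarrow> 'a \<Rightarrow> 'i \<Rightarrow> 'e) \<Rightarrow>
   ('a \<Rightarrow> ('i \<Rightarrow> 'e) \<Rightarrow> 'i \<Rightarrow> 'e) \<Rightarrow>
   ('a \<times> ('i \<Rightarrow> 'e)) \<Rightarrow> ('i \<Rightarrow> 'e \<times> 'e) \<Rightarrow> 'i \<Rightarrow> 'e \<times> 'e" where
  "lift_J2 M nab J u \<xi> = (let (X, Y) = hv_parts M nab u \<xi> in
     vlift u (J (fst u) X) + hlift M nab u (J (fst u) Y))"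

definition lift_J3 ::
  "('a, 'i, 'e::euclidean_space) mfd \<Rightarrow>
   ('a set \<Rightarrow> ('a \<Rightarrow> 'i \<Rightarrow> 'e) \<Rightarrow> ('a \<Rightarrow> 'i \<Rightarrow> 'e) \<Rightarrow> 'a \<Rightarrow> 'i \<Rightarrow> 'e) \<Rightarrow>
   ('a \<Rightarrow> ('i \<Rightarrow> 'e) \<Rightarrow> 'i \<Rightarrow> 'e) \<Rightarrow>
   ('a \<times> ('i \<Rightarrow> 'e)) \<Rightarrow> ('i \<Rightarrow> 'e \<times> 'e) \<Rightarrow> 'i \<Rightarrow> 'e \<times> 'e" where
  "lift_J3 M nab J u = lift_J1 M nab u \<circ> lift_J2 M nab J u"

definition sasaki ::
  "('a, 'i, 'e::euclidean_space) mfd \<Rightarrow>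
   ('a set \<Rightarrow> ('a \<Rightarrow> 'i \<Rightarrow> 'e) \<Rightarrow> ('a \<Rightarrow> 'i \<Rightarrow> 'e) \<Rightarrow> 'a \<Rightarrow> 'i \<Rightarrow> 'e) \<Rightarrow>
   ('a \<Rightarrow> ('i \<Rightarrow> 'e) \<Rightarrow> ('i \<Rightarrow> 'e) \<Rightarrow> real) \<Rightarrow>
   ('a \<times> ('i \<Rightarrow> 'e)) \<Rightarrow> ('i \<Rightarrow> 'e \<times> 'e) \<Rightarrow> ('i \<Rightarrow> 'e \<times> 'e) \<Rightarrow> real" where
  "sasaki M nab g u \<xi> \<eta> =
     (let (X, Y) = hv_parts M nab u \<xi>; (X', Y') = hv_parts M nab u \<eta> in
        g (fst u) X X' + g (fst u) Y Y')"

end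

theory Submission
  imports Defs
begin

text \<open>The heart of the matter is the identification of the tangent space of \<open>TM\<close> at a point \<open>u\<close> over \<open>p\<close>
  with two copies of the tangent space of \<open>M\<close> at \<open>p\<close>, which sends a pair \<open>(X, Y)\<close> to \<open>X\<^sup>H + Y\<^sup>V\<close>. On pairs
  one has \<open>J\<^sub>1 (X, Y) = (-Y, X)\<close>, \<open>J\<^sub>2 (X, Y) = (J Y, J X)\<close> and \<open>J\<^sub>3 (X, Y) = (-J X, J Y)\<close>, and the Sasaki
  metric is \<open>g \<oplus> g\<close>. Hence the quaternionic relations follow from \<open>J\<^sup>2 = -1\<close>
  (\<open>lifted_almost_hypercomplex\<close>), the compatibility of the metric with the three structures from
  \<open>g (J X) (J Y) = - g X Y\<close> (\<open>sasaki_lifted_structures\<close>), and an orthogonal basis of type \<open>(n, n)\<close> at \<open>p\<close>,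
  lifted horizontally and vertically, becomes one of type \<open>(2n, 2n)\<close> at \<open>u\<close> (\<open>sasaki_signature\<close>).

  Three points need work. The horizontal lift is defined by a formula in coordinates, so it has to be
  shown that its values in different charts fit together to a tangent vector (\<open>hlift_tangent\<close>). The
  transition maps of \<open>TM\<close> contain the Jacobians of those of \<open>M\<close>, their derivatives contain second
  derivatives (\<open>TM_jac\<close>), and these cancel against the inhomogeneous term in the transformation law of
  the Christoffel symbols (\<open>Gam_transform\<close>). That law follows from the Leibniz rule and locality of the
  connection.

  Next, \<open>TM\<close> with the induced charts has to be recognised as a manifold (\<open>TM_smooth_manifold\<close>). Its
  topology is the one generated by the charts. For injective charts with open overlaps it remains to
  check that the transition maps are smooth, that points are separated and that countably many charts
  cover the space (\<open>smooth_manifoldI\<close>); the last comes from the Lindelof property of \<open>M\<close>.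

  Finally, the structures on \<open>TM\<close> have to be smooth. In an induced chart the horizontal part of a
  coordinate vector is constant and its vertical part is affine in the Christoffel symbols, with
  coefficients linear in the fibre coordinates (\<open>TM_coord_vec\<close>). So all components are sums of products
  of smooth functions, and closure of the smooth maps under sums, products and compositions suffices.\<close>

section \<open>Calculus of smooth maps on open sets\<close>

lemma Ck_on_subset: "Ck_on k S f \<Longrightarrow> T \<subseteq> S \<Longrightarrow> Ck_on k T f"
  by (induction k arbitrary: f) (auto intro: continuous_on_subset)

text \<open>On an open set the values of a map determine its derivatives. This is what allows the maps below,
  which are only known through their values on the image of a chart, to be replaced by explicit formulas.\<close>

lemma Ck_on_cong:
  assumes "open S" "\<And>x. x \<in> S \<Longrightarrow> f x = h x" "Ck_on k S f"
  shows "Ck_on k S h"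
  using assms(2,3)
proof (induction k arbitrary: f h)
  case 0
  then show ?case using continuous_on_cong[of S S f h] by simp
next
  case (Suc k)
  have D: "(h has_derivative frechet_derivative f (at x)) (at x)" if "x \<in> S" for x
  proof (rule has_derivative_transform_within_open[OF _ assms(1) that])
    show "(f has_derivative frechet_derivative f (at x)) (at x)"
      using Suc.prems(2) that by (simp add: frechet_derivative_works)
  qed (use Suc.prems(1) in auto)
  have eq: "frechet_derivative h (at x) = frechet_derivative f (at x)" if "x \<in> S" for x
    using frechet_derivative_at[OF D[OF that]] by simp
  have "Ck_on k S (\<lambda>x. frechet_derivative h (at x) v)" for v
    by (rule Suc.IH[of "\<lambda>x. frechet_derivative f (at x) v"]) (use Suc.prems eq in auto)
  moreover have "\<forall>x\<in>S. h differentiable (at x)"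
    using D differentiable_def by blast
  ultimately show ?case by simp
qed

lemma Ck_on_continuous: "Ck_on k S f \<Longrightarrow> continuous_on S f"
  by (cases k) (auto intro!: continuous_at_imp_continuous_on differentiable_imp_continuous_within)

lemma Ck_on_lower: "Ck_on (Suc k) S f \<Longrightarrow> Ck_on k S f"
proof (induction k arbitrary: f)
  case 0
  then show ?case using Ck_on_continuous[of "Suc 0"] by simp
next
  case (Suc k)
  have "Ck_on k S (\<lambda>x. frechet_derivative f (at x) v)" for v
    using Suc.prems by (intro Suc.IH) simp
  then show ?case using Suc.prems by simp
qed

lemma Ck_on_const: "Ck_on k S (\<lambda>x. c)"
  by (induction k arbitrary: c) auto

lemma Ck_on_SucI:
  assumes "\<And>x. x \<in> S \<Longrightarrow> (f has_derivative D x) (at x)"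
    and "\<And>v. Ck_on k S (\<lambda>x. D x v)" and "open S"
  shows "Ck_on (Suc k) S f"
proof -
  have "frechet_derivative f (at x) = D x" if "x \<in> S" for x
    using frechet_derivative_at[OF assms(1)[OF that]] by simp
  then have "Ck_on k S (\<lambda>x. frechet_derivative f (at x) v)" for v
    using Ck_on_cong[OF \<open>open S\<close> _ assms(2)[of v]] by auto
  moreover have "\<forall>x\<in>S. f differentiable (at x)"
    using assms(1) differentiable_def by blast
  ultimately show ?thesis by simp
qed

lemma Ck_on_has_derivative:
  "Ck_on (Suc k) S f \<Longrightarrow> x \<in> S \<Longrightarrow> (f has_derivative frechet_derivative f (at x)) (at x)"
  by (auto simp: frechet_derivative_works)

lemma Ck_on_add:
  assumes "open S" "Ck_on k S f" "Ck_on k S h"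
  shows "Ck_on k S (\<lambda>x. f x + h x)"
  using assms(2,3)
proof (induction k arbitrary: f h)
  case 0
  then show ?case by (auto intro: continuous_on_add)
next
  case (Suc k)
  show ?case
  proof (rule Ck_on_SucI[where D = "\<lambda>x v. frechet_derivative f (at x) v + frechet_derivative h (at x) v"])
    show "Ck_on k S (\<lambda>x. frechet_derivative f (at x) v + frechet_derivative h (at x) v)" for v
      using Suc.prems by (intro Suc.IH) simp_all
  qed (use Suc.prems Ck_on_has_derivative assms(1) in \<open>blast intro: has_derivative_add\<close>)+
qed

lemma Ck_on_bounded_linear:
  assumes "open S" "bounded_linear L" "Ck_on k S f"
  shows "Ck_on k S (\<lambda>x. L (f x))"
  using assms(3)
proof (induction k arbitrary: f)
  case 0
  then show ?case using bounded_linear.continuous_on[OF assms(2)] by auto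
next
  case (Suc k)
  show ?case
  proof (rule Ck_on_SucI[where D = "\<lambda>x v. L (frechet_derivative f (at x) v)"])
    show "Ck_on k S (\<lambda>x. L (frechet_derivative f (at x) v))" for v
      using Suc.prems by (intro Suc.IH) simp_all
  qed (use Suc.prems Ck_on_has_derivative assms(1) in
      \<open>blast intro: bounded_linear.has_derivative[OF assms(2)]\<close>)+
qed

text \<open>By the Leibniz rule a derivative of the product is again a sum of such products, in which each factor
  is a derivative or one of the original maps.\<close>

lemma Ck_on_bounded_bilinear:
  assumes "open S" "bounded_bilinear B" "Ck_on k S f" "Ck_on k S h"
  shows "Ck_on k S (\<lambda>x. B (f x) (h x))"
  using assms(3,4)
proof (induction k arbitrary: f h)
  case 0
  then show ?case using bounded_bilinear.continuous_on[OF assms(2)] by auto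
next
  case (Suc k)
  have low: "Ck_on k S f" "Ck_on k S h"
    using Suc.prems Ck_on_lower by blast+
  show ?case
  proof (rule Ck_on_SucI[where D = "\<lambda>x v. B (f x) (frechet_derivative h (at x) v) + B (frechet_derivative f (at x) v) (h x)"])
    show "((\<lambda>x. B (f x) (h x)) has_derivative
        (\<lambda>v. B (f x) (frechet_derivative h (at x) v) + B (frechet_derivative f (at x) v) (h x))) (at x)"
      if "x \<in> S" for x
      by (rule bounded_bilinear.FDERIV[OF assms(2)])
        (use Suc.prems that Ck_on_has_derivative in blast)+
    show "Ck_on k S (\<lambda>x. B (f x) (frechet_derivative h (at x) v) + B (frechet_derivative f (at x) v) (h x))"
      for v
      using Suc low by (intro Ck_on_add[OF assms(1)] Suc.IH) auto
  qed fact
qed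

lemma Ck_on_sum:
  assumes "open S" "\<And>i. i \<in> I \<Longrightarrow> Ck_on k S (f i)"
  shows "Ck_on k S (\<lambda>x. \<Sum>i\<in>I. f i x)"
  using assms(2)
  by (induction I rule: infinite_finite_induct)
    (auto intro: Ck_on_add[OF assms(1)] Ck_on_const)

lemma linear_basis_expansion:
  fixes f :: "'e::euclidean_space \<Rightarrow> 'f::real_vector"
  assumes "linear f"
  shows "f v = (\<Sum>b\<in>Basis. (v \<bullet> b) *\<^sub>R f b)"
  using assms by (metis (mono_tags, lifting) euclidean_representation linear_scale linear_sum sum.cong)

text \<open>The derivative of a composition in a fixed direction \<open>v\<close> is the derivative of the outer map in
  the moving direction \<open>Df v\<close>. Expanding that direction in a basis turns it into a sum of products
  of maps that are covered by the induction hypothesis.\<close>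

lemma Ck_on_compose:
  fixes f :: "'e::euclidean_space \<Rightarrow> 'f::euclidean_space" and h :: "'f \<Rightarrow> 'g::real_normed_vector"
  assumes "open S" "open T" "f ` S \<subseteq> T" "Ck_on k S f" "Ck_on k T h"
  shows "Ck_on k S (\<lambda>x. h (f x))"
  using assms(4,5)
proof (induction k arbitrary: h)
  case 0
  then show ?case using continuous_on_compose2[of T h S f] assms(3) by auto
next
  case (Suc k)
  show ?case
  proof (rule Ck_on_SucI[where D = "\<lambda>x v. frechet_derivative h (at (f x)) (frechet_derivative f (at x) v)"])
    fix v
    have lin: "linear (frechet_derivative h (at (f x)))" if "x \<in> S" for x
      using Suc.prems(2) that assms(3) by (auto intro!: linear_frechet_derivative)
    have "Ck_on k S (\<lambda>x. \<Sum>b\<in>Basis. (frechet_derivative f (at x) v \<bullet> b) *\<^sub>R frechet_derivative h (at (f x)) b)"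
    proof (intro Ck_on_sum Ck_on_bounded_bilinear[OF _ bounded_bilinear_scaleR] assms(1))
      fix b
      show "Ck_on k S (\<lambda>x. frechet_derivative f (at x) v \<bullet> b)"
        using Suc.prems by (intro Ck_on_bounded_linear[OF assms(1) bounded_linear_inner_left]) simp
      show "Ck_on k S (\<lambda>x. frechet_derivative h (at (f x)) b)"
        using Suc.prems Ck_on_lower by (intro Suc.IH) auto
    qed
    then show "Ck_on k S (\<lambda>x. frechet_derivative h (at (f x)) (frechet_derivative f (at x) v))"
      by (rule Ck_on_cong[OF assms(1), rotated]) (simp add: linear_basis_expansion[OF lin, symmetric])
  next
    fix x assume "x \<in> S"
    then have "f x \<in> T" using assms(3) by auto
    then show "((\<lambda>x. h (f x)) has_derivative
        (\<lambda>v. frechet_derivative h (at (f x)) (frechet_derivative f (at x) v))) (at x)"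
      using diff_chain_at[of f _ x h] Ck_on_has_derivative[OF Suc.prems(1) \<open>x \<in> S\<close>]
        Ck_on_has_derivative[OF Suc.prems(2)] unfolding o_def by blast
  qed fact
qed

lemma smooth_on_subset: "smooth_on S f \<Longrightarrow> T \<subseteq> S \<Longrightarrow> smooth_on T f"
  unfolding smooth_on_def using Ck_on_subset by blast

lemma smooth_on_cong:
  "open S \<Longrightarrow> smooth_on S f \<Longrightarrow> (\<And>x. x \<in> S \<Longrightarrow> f x = h x) \<Longrightarrow> smooth_on S h"
  unfolding smooth_on_def using Ck_on_cong by blast

lemma smooth_on_continuous: "smooth_on S f \<Longrightarrow> continuous_on S f"
  unfolding smooth_on_def using Ck_on_continuous by blast

lemma smooth_on_has_derivative:
  "smooth_on S f \<Longrightarrow> x \<in> S \<Longrightarrow> (f has_derivative frechet_derivative f (at x)) (at x)"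
  unfolding smooth_on_def using Ck_on_has_derivative by blast

lemma smooth_on_linear_derivative:
  "smooth_on S f \<Longrightarrow> x \<in> S \<Longrightarrow> linear (frechet_derivative f (at x))"
  using smooth_on_has_derivative has_derivative_linear by blast

lemma smooth_on_derivative: "smooth_on S f \<Longrightarrow> smooth_on S (\<lambda>x. frechet_derivative f (at x) v)"
  unfolding smooth_on_def by (metis Ck_on.simps(2))

lemma smooth_on_const [simp]: "smooth_on S (\<lambda>x. c)"
  unfolding smooth_on_def using Ck_on_const by blast

lemma smooth_on_ident:
  assumes "open S" shows "smooth_on S (\<lambda>x. x)"
proof -
  have "Ck_on k S (\<lambda>x. x)" for k
  proof (cases k)
    case (Suc m)
    then show ?thesis
      using Ck_on_SucI[where D = "\<lambda>x v. v" and S = S and f = "\<lambda>x. x" and k = m] Ck_on_const assms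
        has_derivative_ident by blast
  qed (simp add: continuous_on_id)
  then show ?thesis unfolding smooth_on_def by blast
qed

lemma smooth_on_add: "open S \<Longrightarrow> smooth_on S f \<Longrightarrow> smooth_on S h \<Longrightarrow> smooth_on S (\<lambda>x. f x + h x)"
  unfolding smooth_on_def using Ck_on_add by blast

lemma smooth_on_sum:
  "open S \<Longrightarrow> (\<And>i. i \<in> I \<Longrightarrow> smooth_on S (f i)) \<Longrightarrow> smooth_on S (\<lambda>x. \<Sum>i\<in>I. f i x)"
  by (simp add: smooth_on_def Ck_on_sum)

lemma smooth_on_bounded_linear:
  "open S \<Longrightarrow> bounded_linear L \<Longrightarrow> smooth_on S f \<Longrightarrow> smooth_on S (\<lambda>x. L (f x))"
  unfolding smooth_on_def using Ck_on_bounded_linear by blast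

lemma smooth_on_minus: "open S \<Longrightarrow> smooth_on S f \<Longrightarrow> smooth_on S (\<lambda>x. - f x)"
  using smooth_on_bounded_linear[OF _ bounded_linear_minus[OF bounded_linear_ident]] by blast

lemma smooth_on_inner: "open S \<Longrightarrow> smooth_on S f \<Longrightarrow> smooth_on S (\<lambda>x. f x \<bullet> b)"
  using smooth_on_bounded_linear[OF _ bounded_linear_inner_left] by blast

lemma smooth_on_fst: "open S \<Longrightarrow> smooth_on S f \<Longrightarrow> smooth_on S (\<lambda>x. fst (f x))"
  using smooth_on_bounded_linear[OF _ bounded_linear_fst] by blast

lemma smooth_on_snd: "open S \<Longrightarrow> smooth_on S f \<Longrightarrow> smooth_on S (\<lambda>x. snd (f x))"
  using smooth_on_bounded_linear[OF _ bounded_linear_snd] by blast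

lemma smooth_on_scaleR:
  "open S \<Longrightarrow> smooth_on S f \<Longrightarrow> smooth_on S h \<Longrightarrow> smooth_on S (\<lambda>x. f x *\<^sub>R h x)"
  unfolding smooth_on_def using Ck_on_bounded_bilinear[OF _ bounded_bilinear_scaleR] by blast

lemma smooth_on_Pair:
  assumes "open S" "smooth_on S f" "smooth_on S h"
  shows "smooth_on S (\<lambda>x. (f x, h x))"
proof -
  have "smooth_on S (\<lambda>x. (f x, 0) + (0, h x))"
    using assms
    by (intro smooth_on_add smooth_on_bounded_linear[where L = "\<lambda>a. (a, 0)"]
        smooth_on_bounded_linear[where L = "\<lambda>a. (0, a)"])
      (auto intro!: bounded_linear_Pair bounded_linear_ident bounded_linear_zero)
  then show ?thesis by simp
qed

lemma smooth_on_compose: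
  fixes f :: "'e::euclidean_space \<Rightarrow> 'f::euclidean_space" and h :: "'f \<Rightarrow> 'g::real_normed_vector"
  shows "open S \<Longrightarrow> open T \<Longrightarrow> f ` S \<subseteq> T \<Longrightarrow> smooth_on S f \<Longrightarrow> smooth_on T h \<Longrightarrow> smooth_on S (\<lambda>x. h (f x))"
  unfolding smooth_on_def using Ck_on_compose by blast

text \<open>A vector that depends smoothly on \<open>x\<close>, inserted into a linear map that does so too, gives a smooth
  result: only finitely many smooth coefficients are involved. The smoothness of
  a tensor field is defined by its values on coordinate vectors of basis directions; this is how it
  carries over to moving directions.\<close>

lemma smooth_on_linear_combination:
  fixes a :: "'e::euclidean_space \<Rightarrow> 'f::euclidean_space" and L :: "'e \<Rightarrow> 'f \<Rightarrow> 'g::real_normed_vector"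
  assumes "open S" "smooth_on S a" "\<And>b. b \<in> Basis \<Longrightarrow> smooth_on S (\<lambda>x. L x b)"
    and "\<And>x. x \<in> S \<Longrightarrow> linear (L x)"
  shows "smooth_on S (\<lambda>x. L x (a x))"
proof (rule smooth_on_cong[OF assms(1)])
  show "smooth_on S (\<lambda>x. \<Sum>b\<in>Basis. (a x \<bullet> b) *\<^sub>R L x b)"
    using assms by (intro smooth_on_sum smooth_on_scaleR smooth_on_inner) auto
qed (simp add: linear_basis_expansion[OF assms(4), symmetric])

section \<open>Charts and tangent vectors\<close>

abbreviation jac :: "('a, 'i, 'e::euclidean_space) mfd \<Rightarrow> 'i \<Rightarrow> 'i \<Rightarrow> 'a \<Rightarrow> 'e \<Rightarrow> 'e" where
  "jac M i j p \<equiv> frechet_derivative (transition M i j) (at (cmap M i p))"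

locale smooth_mfd =
  fixes M :: "('a, 'i, 'e::euclidean_space) mfd" and d :: nat
  assumes smooth_manifold: "smooth_manifold M d"
begin

lemma openin_cdom: "i \<in> charts M \<Longrightarrow> openin (mtop M) (cdom M i)"
  using smooth_manifold by (simp add: smooth_manifold_def)

lemma cmap_homeomorphic:
  "i \<in> charts M \<Longrightarrow>
    homeomorphic_map (subtopology (mtop M) (cdom M i)) (top_of_set (cmap M i ` cdom M i)) (cmap M i)"
  using smooth_manifold by (simp add: smooth_manifold_def)

lemma inj_cmap: "i \<in> charts M \<Longrightarrow> inj_on (cmap M i) (cdom M i)"
  using homeomorphic_imp_injective_map[OF cmap_homeomorphic] openin_subset[OF openin_cdom]
  by (simp add: inf_absorb2)

lemma cinv_cmap [simp]: "i \<in> charts M \<Longrightarrow> p \<in> cdom M i \<Longrightarrow> cinv M i (cmap M i p) = p"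
  using inj_cmap by (simp add: cinv_def)

lemma transition_cmap: "i \<in> charts M \<Longrightarrow> p \<in> cdom M i \<Longrightarrow> transition M i j (cmap M i p) = cmap M j p"
  by (simp add: transition_def)

lemma open_cmap_image:
  assumes "openin (mtop M) U" "i \<in> charts M" "U \<subseteq> cdom M i"
  shows "open (cmap M i ` U)"
proof -
  have "openin (subtopology (mtop M) (cdom M i)) U"
    using assms by (simp add: openin_subset_topspace_eq openin_open_subtopology openin_cdom)
  then have "openin (top_of_set (cmap M i ` cdom M i)) (cmap M i ` U)"
    using homeomorphic_imp_open_map[OF cmap_homeomorphic[OF assms(2)]] open_map_def by blast
  moreover have "open (cmap M i ` cdom M i)"
    using smooth_manifold assms(2) by (simp add: smooth_manifold_def)
  ultimately show ?thesis by (simp add: openin_open_eq)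
qed

lemma open_overlap:
  assumes "openin (mtop M) U" "i \<in> charts M"
  shows "open (cmap M i ` (U \<inter> cdom M i))" "open (cmap M i ` (cdom M i \<inter> U))"
  using assms by (auto intro!: open_cmap_image openin_Int openin_cdom)

lemma open_cmap_cdom: "i \<in> charts M \<Longrightarrow> open (cmap M i ` cdom M i)"
  by (simp add: open_cmap_image openin_cdom)

lemma smooth_transition:
  "i \<in> charts M \<Longrightarrow> j \<in> charts M \<Longrightarrow> smooth_on (cmap M i ` (cdom M i \<inter> cdom M j)) (transition M i j)"
  using smooth_manifold by (simp add: smooth_manifold_def)

lemma chart_at_exists: "p \<in> topspace (mtop M) \<Longrightarrow> \<exists>i. chart_at M i p"
  using smooth_manifold by (fastforce simp: smooth_manifold_def chart_at_def)

lemma chart_at_topspace: "chart_at M i p \<Longrightarrow> p \<in> topspace (mtop M)"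
  using smooth_manifold by (fastforce simp: smooth_manifold_def chart_at_def)

lemma transition_has_derivative:
  assumes "chart_at M i p" "chart_at M j p"
  shows "(transition M i j has_derivative jac M i j p) (at (cmap M i p))"
  using assms smooth_on_has_derivative[OF smooth_transition] by (auto simp: chart_at_def)

lemma linear_jac: "chart_at M i p \<Longrightarrow> chart_at M j p \<Longrightarrow> linear (jac M i j p)"
  using transition_has_derivative has_derivative_linear by blast

lemma jac_refl:
  assumes "chart_at M i p"
  shows "jac M i i p v = v"
proof -
  have "(transition M i i has_derivative (\<lambda>v. v)) (at (cmap M i p))"
    by (rule has_derivative_transform_within_open[OF has_derivative_ident open_cmap_cdom[of i]])
      (use assms in \<open>auto simp: chart_at_def transition_cmap\<close>)
  then show ?thesis using frechet_derivative_at by metis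
qed

text \<open>The chain rule, as the cocycle condition for the Jacobians. It makes a vector of components in one
  chart extend to a tangent vector.\<close>

lemma jac_comp:
  assumes "chart_at M i p" "chart_at M j p" "chart_at M k p"
  shows "jac M j k p (jac M i j p v) = jac M i k p v"
proof -
  have ch: "i \<in> charts M" "j \<in> charts M" "k \<in> charts M" "p \<in> cdom M i" "p \<in> cdom M j" "p \<in> cdom M k"
    using assms by (auto simp: chart_at_def)
  have "(transition M j k \<circ> transition M i j has_derivative jac M j k p \<circ> jac M i j p) (at (cmap M i p))"
    using transition_has_derivative[OF assms(1,2)] transition_has_derivative[OF assms(2,3)] ch
    by (intro diff_chain_at) (simp_all add: transition_cmap)
  then have "(transition M i k has_derivative jac M j k p \<circ> jac M i j p) (at (cmap M i p))"
    by (rule has_derivative_transform_within_open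
        [where s = "cmap M i ` ((cdom M j \<inter> cdom M k) \<inter> cdom M i)"])
      (use ch in \<open>auto intro!: open_overlap openin_Int openin_cdom simp: transition_cmap\<close>)
  then show ?thesis using frechet_derivative_at by (metis comp_apply)
qed

lemma tangent_transform:
  "v \<in> tangent_space M p \<Longrightarrow> chart_at M i p \<Longrightarrow> chart_at M j p \<Longrightarrow> v j = jac M i j p (v i)"
  unfolding tangent_space_def by blast

lemma tangent_padding: "v \<in> tangent_space M p \<Longrightarrow> \<not> chart_at M i p \<Longrightarrow> v i = 0"
  unfolding tangent_space_def by blast

lemma tangentI:
  assumes "\<And>i. \<not> chart_at M i p \<Longrightarrow> v i = 0"
    and "\<And>i j. chart_at M i p \<Longrightarrow> chart_at M j p \<Longrightarrow> v j = jac M i j p (v i)"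
  shows "v \<in> tangent_space M p"
  using assms unfolding tangent_space_def by blast

lemma tangent_eqI:
  assumes "v \<in> tangent_space M p" "w \<in> tangent_space M p" "chart_at M i p" "v i = w i"
  shows "v = w"
proof
  fix j
  show "v j = w j"
    using assms by (cases "chart_at M j p") (metis tangent_transform, metis tangent_padding)
qed

lemma coord_vec_apply: "chart_at M j p \<Longrightarrow> coord_vec M i a p j = jac M i j p a"
  by (simp add: coord_vec_def)

lemma coord_vec_self: "chart_at M i p \<Longrightarrow> coord_vec M i a p i = a"
  by (simp add: coord_vec_apply jac_refl)

lemma coord_vec_tangent: "chart_at M i p \<Longrightarrow> coord_vec M i a p \<in> tangent_space M p"
  by (rule tangentI) (simp_all add: coord_vec_def jac_comp)

lemma tangent_eq_coord_vec:
  "v \<in> tangent_space M p \<Longrightarrow> chart_at M i p \<Longrightarrow> v = coord_vec M i (v i) p"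
  by (rule tangent_eqI[where i = i]) (auto simp: coord_vec_tangent coord_vec_self)

lemma subspace_tangent_space: "subspace (tangent_space M p)"
  unfolding subspace_def
proof (intro conjI ballI allI)
  show "0 \<in> tangent_space M p"
    by (rule tangentI) (simp_all add: linear_0[OF linear_jac])
  show "v + w \<in> tangent_space M p" if "v \<in> tangent_space M p" "w \<in> tangent_space M p" for v w
  proof (rule tangentI)
    fix i j assume "chart_at M i p" "chart_at M j p"
    then show "(v + w) j = jac M i j p ((v + w) i)"
      using tangent_transform[OF that(1), of i j] tangent_transform[OF that(2), of i j] linear_add[OF linear_jac, of i p j "v i" "w i"]
      by simp
  qed (simp add: tangent_padding[OF that(1)] tangent_padding[OF that(2)])
  show "c *\<^sub>R v \<in> tangent_space M p" if "v \<in> tangent_space M p" for c v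
  proof (rule tangentI)
    fix i j assume "chart_at M i p" "chart_at M j p"
    then show "(c *\<^sub>R v) j = jac M i j p ((c *\<^sub>R v) i)"
      using tangent_transform[OF that, of i j] linear_scale[OF linear_jac, of i p j c "v i"]
      by (simp add: scaleR_fun_def)
  qed (simp add: tangent_padding[OF that] scaleR_fun_def)
qed

lemma linear_coord_vec: "chart_at M i p \<Longrightarrow> linear (\<lambda>a. coord_vec M i a p)"
  by (rule linearI)
    (auto simp: coord_vec_def fun_eq_iff scaleR_fun_def linear_add[OF linear_jac] linear_scale[OF linear_jac])

lemma smooth_jac:
  assumes "i \<in> charts M" "j \<in> charts M"
  shows "smooth_on (cmap M i ` (cdom M i \<inter> cdom M j)) (\<lambda>x. jac M i j (cinv M i x) a)"
  by (rule smooth_on_cong[OF _ smooth_on_derivative[OF smooth_transition[OF assms], of a]])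
    (use assms in \<open>auto intro!: open_overlap openin_cdom\<close>)

text \<open>Two charts differ by a transition map, which is smooth; so a test in one chart around \<open>U\<close> replaces the
  tests in all charts that the definitions of smooth functions and vector fields ask for.\<close>

lemma smooth_change_chart:
  fixes F :: "'a \<Rightarrow> 'g::real_normed_vector"
  assumes "i \<in> charts M" "k \<in> charts M" "openin (mtop M) U" "U \<subseteq> cdom M i"
    and "smooth_on (cmap M i ` U) (\<lambda>x. F (cinv M i x))"
  shows "smooth_on (cmap M k ` (U \<inter> cdom M k)) (\<lambda>x. F (cinv M k x))"
proof (rule smooth_on_cong)
  show "smooth_on (cmap M k ` (U \<inter> cdom M k)) (\<lambda>x. F (cinv M i (transition M k i x)))"
  proof (rule smooth_on_compose[where T = "cmap M i ` U"])
    show "smooth_on (cmap M k ` (U \<inter> cdom M k)) (transition M k i)"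
      by (rule smooth_on_subset[OF smooth_transition]) (use assms in auto)
  qed (use assms in \<open>auto intro!: open_overlap open_cmap_image simp: transition_cmap\<close>)
  show "F (cinv M i (transition M k i x)) = F (cinv M k x)" if "x \<in> cmap M k ` (U \<inter> cdom M k)" for x
    using that assms by (auto simp: transition_cmap)
qed (use assms in \<open>auto intro!: open_overlap\<close>)

lemma smooth_funI:
  assumes "i \<in> charts M" "openin (mtop M) U" "U \<subseteq> cdom M i" "smooth_on (cmap M i ` U) (\<lambda>x. f (cinv M i x))"
  shows "smooth_fun M U f"
  unfolding smooth_fun_def o_def using smooth_change_chart[OF assms(1) _ assms(2-4)] by blast

text \<open>The component along a chart \<open>k\<close> is first seen to be smooth in the chart \<open>i\<close>, where it is an entry of
  a Jacobian, and then transported to \<open>k\<close>.\<close>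

lemma coord_vec_vector_field:
  assumes "i \<in> charts M" "openin (mtop M) U" "U \<subseteq> cdom M i"
  shows "coord_vec M i a \<in> vector_fields M U"
proof -
  have "smooth_on (cmap M k ` (U \<inter> cdom M k)) (\<lambda>x. coord_vec M i a (cinv M k x) k)" if k: "k \<in> charts M" for k
  proof -
    let ?U = "U \<inter> cdom M k"
    have U: "openin (mtop M) ?U" "?U \<subseteq> cdom M i"
      using assms k by (auto intro: openin_Int openin_cdom)
    have "smooth_on (cmap M i ` ?U) (\<lambda>x. coord_vec M i a (cinv M i x) k)"
    proof (rule smooth_on_cong)
      show "smooth_on (cmap M i ` ?U) (\<lambda>x. jac M i k (cinv M i x) a)"
        by (rule smooth_on_subset[OF smooth_jac]) (use assms k in auto)
      show "jac M i k (cinv M i x) a = coord_vec M i a (cinv M i x) k" if "x \<in> cmap M i ` ?U" for x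
        using that U(2) assms(1) k by (auto simp: coord_vec_apply chart_at_def subset_iff)
    qed (rule open_cmap_image[OF U(1) assms(1) U(2)])
    then show ?thesis
      using smooth_change_chart[OF assms(1) k U(1,2), of "\<lambda>q. coord_vec M i a q k"] by simp
  qed
  then show ?thesis
    using assms by (auto simp: vector_fields_def chart_at_def intro!: coord_vec_tangent)
qed

lemma vector_fields_add:
  assumes "openin (mtop M) U" "X \<in> vector_fields M U" "Y \<in> vector_fields M U"
  shows "(\<lambda>q. X q + Y q) \<in> vector_fields M U"
  using assms open_overlap(1)[OF assms(1)]
  by (auto simp: vector_fields_def intro!: subspace_add[OF subspace_tangent_space] smooth_on_add)

lemma vector_fields_scale:
  assumes "openin (mtop M) U" "X \<in> vector_fields M U" "smooth_fun M U f"
  shows "(\<lambda>q. f q *\<^sub>R X q) \<in> vector_fields M U"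
  using assms open_overlap(1)[OF assms(1)]
  by (auto simp: vector_fields_def smooth_fun_def o_def scaleR_fun_def
      intro!: smooth_on_scaleR subspace_scale[OF subspace_tangent_space, unfolded scaleR_fun_def])

lemma vector_fields_zero: "(\<lambda>q. 0) \<in> vector_fields M U"
  by (auto simp: vector_fields_def subspace_0[OF subspace_tangent_space])

lemma vector_fields_combination:
  assumes "openin (mtop M) U" "finite I"
    and "\<And>c. c \<in> I \<Longrightarrow> X c \<in> vector_fields M U" "\<And>c. c \<in> I \<Longrightarrow> smooth_fun M U (f c)"
  shows "(\<lambda>q. \<Sum>c\<in>I. f c q *\<^sub>R X c q) \<in> vector_fields M U"
  using assms(2-)
  by (induction I rule: finite_induct)
    (auto simp: vector_fields_zero intro!: vector_fields_add[OF assms(1)] vector_fields_scale[OF assms(1)])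

text \<open>By the chain rule the arbitrarily selected chart in the definition may be replaced by the chart at
  hand.\<close>

lemma dir_deriv_chart:
  assumes "smooth_fun M U f" "openin (mtop M) U" "p \<in> U" "chart_at M i p" "v \<in> tangent_space M p"
  shows "dir_deriv M f p v = frechet_derivative (\<lambda>x. f (cinv M i x)) (at (cmap M i p)) (v i)"
proof -
  define k where "k = (SOME i. chart_at M i p)"
  have k: "chart_at M k p"
    unfolding k_def using assms(4) by (rule someI)
  have ch: "i \<in> charts M" "k \<in> charts M" "p \<in> cdom M i" "p \<in> cdom M k"
    using assms(4) k by (auto simp: chart_at_def)
  let ?D = "frechet_derivative (f \<circ> cinv M k) (at (cmap M k p))"
  have "smooth_on (cmap M k ` (U \<inter> cdom M k)) (f \<circ> cinv M k)"
    using assms(1) ch by (simp add: smooth_fun_def)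
  then have "((f \<circ> cinv M k) has_derivative ?D) (at (cmap M k p))"
    by (rule smooth_on_has_derivative) (use assms(3) ch in auto)
  then have "((f \<circ> cinv M k) \<circ> transition M i k has_derivative ?D \<circ> jac M i k p) (at (cmap M i p))"
    using transition_has_derivative[OF assms(4) k] ch by (intro diff_chain_at) (simp_all add: transition_cmap)
  then have "((\<lambda>x. f (cinv M i x)) has_derivative ?D \<circ> jac M i k p) (at (cmap M i p))"
    by (rule has_derivative_transform_within_open[where s = "cmap M i ` (cdom M k \<inter> cdom M i)"])
      (use ch in \<open>auto intro!: open_overlap openin_cdom simp: transition_cmap\<close>)
  then have "frechet_derivative (\<lambda>x. f (cinv M i x)) (at (cmap M i p)) (v i) = ?D (jac M i k p (v i))"
    using frechet_derivative_at by (metis comp_apply)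
  also have "\<dots> = ?D (v k)"
    using tangent_transform[OF assms(5,4) k] by simp
  finally show ?thesis by (simp add: dir_deriv_def Let_def k_def)
qed

end

section \<open>Torsion-free connections in charts\<close>

lemma sum_fun_apply: "(\<Sum>i\<in>I. f i) x = (\<Sum>i\<in>I. f i x)"
  for f :: "'c \<Rightarrow> 'b \<Rightarrow> 'v::comm_monoid_add"
  by (induction I rule: infinite_finite_induct) auto

locale torsion_free_connection = smooth_mfd M d
  for M :: "('a, 'i, 'e::euclidean_space) mfd" and d +
  fixes nab :: "'a set \<Rightarrow> ('a \<Rightarrow> 'i \<Rightarrow> 'e) \<Rightarrow> ('a \<Rightarrow> 'i \<Rightarrow> 'e) \<Rightarrow> 'a \<Rightarrow> 'i \<Rightarrow> 'e"
  assumes affine: "affine_connection M nab"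
    and torsion_free: "\<lbrakk>openin (mtop M) U; X \<in> vector_fields M U; Y \<in> vector_fields M U; p \<in> U\<rbrakk>
      \<Longrightarrow> nab U X Y p - nab U Y X p = lie_bracket M X Y p"
begin

lemmas nab_axioms = affine[unfolded affine_connection_def, THEN conjunct1, rule_format]
lemmas nab_restriction = affine[unfolded affine_connection_def, THEN conjunct2, rule_format]

lemma nab_vector_field:
  "openin (mtop M) U \<Longrightarrow> X \<in> vector_fields M U \<Longrightarrow> Y \<in> vector_fields M U \<Longrightarrow> nab U X Y \<in> vector_fields M U"
  using nab_axioms by blast

text \<open>Coordinate fields of a chart are meaningless outside its domain, so an identity between fields usually
  holds only on an open set; locality, also with \<open>U = V\<close>, permits using it under the connection.\<close>

lemma nab_local:
  assumes "openin (mtop M) U" "openin (mtop M) V" "V \<subseteq> U" "X \<in> vector_fields M U" "Y \<in> vector_fields M U"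
    "X' \<in> vector_fields M V" "Y' \<in> vector_fields M V" "\<And>q. q \<in> V \<Longrightarrow> X' q = X q"
    "\<And>q. q \<in> V \<Longrightarrow> Y' q = Y q" "p \<in> V"
  shows "nab V X' Y' p = nab U X Y p"
  by (rule nab_restriction[OF assms(1-7) _ assms(10)]) (simp add: assms(8,9))

lemma nab_add_left:
  assumes "openin (mtop M) U" "X \<in> vector_fields M U" "Y \<in> vector_fields M U" "Z \<in> vector_fields M U" "p \<in> U"
  shows "nab U (\<lambda>q. X q + Z q) Y p = nab U X Y p + nab U Z Y p"
  using nab_axioms[OF assms(1-3)] assms(4,5) by blast

lemma nab_add_right:
  assumes "openin (mtop M) U" "X \<in> vector_fields M U" "Y \<in> vector_fields M U" "Z \<in> vector_fields M U" "p \<in> U"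
  shows "nab U X (\<lambda>q. Y q + Z q) p = nab U X Y p + nab U X Z p"
  using nab_axioms[OF assms(1-3)] assms(4,5) by blast

lemma nab_scale_left:
  assumes "openin (mtop M) U" "X \<in> vector_fields M U" "Y \<in> vector_fields M U" "smooth_fun M U f" "p \<in> U"
  shows "nab U (\<lambda>q. f q *\<^sub>R X q) Y p = f p *\<^sub>R nab U X Y p"
  using nab_axioms[OF assms(1-3)] assms(4,5) by blast

lemma nab_scale_right:
  assumes "openin (mtop M) U" "X \<in> vector_fields M U" "Y \<in> vector_fields M U" "smooth_fun M U f" "p \<in> U"
  shows "nab U X (\<lambda>q. f q *\<^sub>R Y q) p = dir_deriv M f p (X p) *\<^sub>R Y p + f p *\<^sub>R nab U X Y p"
  using nab_axioms[OF assms(1-3)] assms(4,5) by blast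

lemma nab_combination_left:
  assumes "openin (mtop M) U" "Y \<in> vector_fields M U" "p \<in> U" "finite I"
    and "\<And>c. c \<in> I \<Longrightarrow> X c \<in> vector_fields M U" "\<And>c. c \<in> I \<Longrightarrow> smooth_fun M U (f c)"
  shows "nab U (\<lambda>q. \<Sum>c\<in>I. f c q *\<^sub>R X c q) Y p = (\<Sum>c\<in>I. f c p *\<^sub>R nab U (X c) Y p)"
  using assms(4-)
proof (induction I rule: finite_induct)
  case empty
  have "nab U (\<lambda>q. 0) Y p = nab U (\<lambda>q. 0) Y p + nab U (\<lambda>q. 0) Y p"
    using nab_add_left[OF assms(1) vector_fields_zero assms(2) vector_fields_zero assms(3)] by simp
  then show ?case by (simp add: zero_fun_def)
next
  case (insert c I)
  have "nab U (\<lambda>q. f c q *\<^sub>R X c q + (\<Sum>c\<in>I. f c q *\<^sub>R X c q)) Y p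
      = nab U (\<lambda>q. f c q *\<^sub>R X c q) Y p + nab U (\<lambda>q. \<Sum>c\<in>I. f c q *\<^sub>R X c q) Y p"
    using insert.prems insert.hyps(1) assms(1-3)
    by (intro nab_add_left vector_fields_combination vector_fields_scale) simp_all
  moreover have "nab U (\<lambda>q. f c q *\<^sub>R X c q) Y p = f c p *\<^sub>R nab U (X c) Y p"
    using insert.prems assms(1-3) by (intro nab_scale_left) simp_all
  ultimately show ?case using insert by (simp add: plus_fun_def)
qed

lemma nab_combination_right:
  assumes "openin (mtop M) U" "X \<in> vector_fields M U" "p \<in> U" "finite I"
    and "\<And>c. c \<in> I \<Longrightarrow> Y c \<in> vector_fields M U" "\<And>c. c \<in> I \<Longrightarrow> smooth_fun M U (f c)"
  shows "nab U X (\<lambda>q. \<Sum>c\<in>I. f c q *\<^sub>R Y c q) p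
    = (\<Sum>c\<in>I. dir_deriv M (f c) p (X p) *\<^sub>R Y c p + f c p *\<^sub>R nab U X (Y c) p)"
  using assms(4-)
proof (induction I rule: finite_induct)
  case empty
  have "nab U X (\<lambda>q. 0) p = nab U X (\<lambda>q. 0) p + nab U X (\<lambda>q. 0) p"
    using nab_add_right[OF assms(1,2) vector_fields_zero vector_fields_zero assms(3)] by simp
  then show ?case by (simp add: zero_fun_def)
next
  case (insert c I)
  have "nab U X (\<lambda>q. f c q *\<^sub>R Y c q + (\<Sum>c\<in>I. f c q *\<^sub>R Y c q)) p
      = nab U X (\<lambda>q. f c q *\<^sub>R Y c q) p + nab U X (\<lambda>q. \<Sum>c\<in>I. f c q *\<^sub>R Y c q) p"
    using insert.prems insert.hyps(1) assms(1-3)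
    by (intro nab_add_right vector_fields_combination vector_fields_scale) simp_all
  moreover have "nab U X (\<lambda>q. f c q *\<^sub>R Y c q) p
      = dir_deriv M (f c) p (X p) *\<^sub>R Y c p + f c p *\<^sub>R nab U X (Y c) p"
    using insert.prems assms(1-3) by (intro nab_scale_right) simp_all
  ultimately show ?case using insert by (simp add: plus_fun_def)
qed

text \<open>All Christoffel symbols of a chart at once: the vector \<open>\<Gamma>(a, b)\<close>, bilinear in \<open>a\<close> and \<open>b\<close>.\<close>

definition Gam :: "'i \<Rightarrow> 'a \<Rightarrow> 'e \<Rightarrow> 'e \<Rightarrow> 'e" where
  "Gam i p a b = nab (cdom M i) (coord_vec M i a) (coord_vec M i b) p i"

lemma coord_vec_cdom: "i \<in> charts M \<Longrightarrow> coord_vec M i a \<in> vector_fields M (cdom M i)"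
  by (simp add: coord_vec_vector_field openin_cdom)

lemma smooth_fun_const: "smooth_fun M U (\<lambda>q. c)"
  by (simp add: smooth_fun_def o_def)

lemma coord_vec_combination:
  assumes "chart_at M i q"
  shows "coord_vec M i a q = (\<Sum>c\<in>Basis. (a \<bullet> c) *\<^sub>R coord_vec M i c q)"
  by (rule linear_basis_expansion[OF linear_coord_vec[OF assms]])

lemma Gam_linear_left:
  assumes "chart_at M i p"
  shows "Gam i p a b = (\<Sum>c\<in>Basis. (a \<bullet> c) *\<^sub>R Gam i p c b)"
proof -
  have i: "i \<in> charts M" "p \<in> cdom M i" using assms by (auto simp: chart_at_def)
  let ?X = "\<lambda>q. \<Sum>c\<in>Basis. (a \<bullet> c) *\<^sub>R coord_vec M i c q"
  have X: "?X \<in> vector_fields M (cdom M i)"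
    by (intro vector_fields_combination openin_cdom coord_vec_cdom smooth_fun_const i finite_Basis)
  have "nab (cdom M i) (coord_vec M i a) (coord_vec M i b) p = nab (cdom M i) ?X (coord_vec M i b) p"
    by (rule nab_local)
      (use i X in \<open>auto intro!: openin_cdom coord_vec_cdom coord_vec_combination simp: chart_at_def\<close>)
  also have "\<dots> = (\<Sum>c\<in>Basis. (a \<bullet> c) *\<^sub>R nab (cdom M i) (coord_vec M i c) (coord_vec M i b) p)"
    by (intro nab_combination_left openin_cdom coord_vec_cdom smooth_fun_const i finite_Basis)
  finally show ?thesis by (simp add: Gam_def sum_fun_apply scaleR_fun_def)
qed

text \<open>Coordinate fields of one chart commute, since their components in that chart are constant.\<close>

lemma Gam_sym:
  assumes "chart_at M i p"
  shows "Gam i p a b = Gam i p b a"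
proof -
  have i: "i \<in> charts M" "p \<in> cdom M i" using assms by (auto simp: chart_at_def)
  have const: "frechet_derivative (\<lambda>x. coord_vec M i c (cinv M i x) i) (at (cmap M i p)) = (\<lambda>v. 0)" for c
  proof -
    have "((\<lambda>x. coord_vec M i c (cinv M i x) i) has_derivative (\<lambda>v. 0)) (at (cmap M i p))"
      by (rule has_derivative_transform_within_open[OF has_derivative_const[of c] open_cmap_cdom[of i]])
        (use i in \<open>auto simp: coord_vec_self chart_at_def\<close>)
    then show ?thesis using frechet_derivative_at by metis
  qed
  have "lie_bracket M (coord_vec M i a) (coord_vec M i b) p i = 0"
    by (simp add: lie_bracket_def const)
  then have "(nab (cdom M i) (coord_vec M i a) (coord_vec M i b) p
      - nab (cdom M i) (coord_vec M i b) (coord_vec M i a) p) i = 0"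
    using i by (simp only: torsion_free openin_cdom coord_vec_cdom)
  then show ?thesis by (simp add: Gam_def)
qed

lemma linear_Gam_left: "chart_at M i p \<Longrightarrow> linear (\<lambda>a. Gam i p a b)"
  by (subst Gam_linear_left, assumption)
    (intro linear_compose_sum linear_compose_scale_right ballI linear_scaleR_left
      bounded_linear.linear[OF bounded_linear_scaleR_const[OF bounded_linear_inner_left]])

lemma linear_Gam_right: "chart_at M i p \<Longrightarrow> linear (Gam i p a)"
  using linear_Gam_left[of i p a] by (simp only: Gam_sym[of i p _ a])

lemma smooth_Gam:
  assumes "i \<in> charts M"
  shows "smooth_on (cmap M i ` cdom M i) (\<lambda>x. Gam i (cinv M i x) a b)"
proof -
  have "nab (cdom M i) (coord_vec M i a) (coord_vec M i b) \<in> vector_fields M (cdom M i)"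
    using assms by (intro nab_vector_field openin_cdom coord_vec_cdom)
  then have "smooth_on (cmap M i ` (cdom M i \<inter> cdom M i))
      (\<lambda>x. nab (cdom M i) (coord_vec M i a) (coord_vec M i b) (cinv M i x) i)"
    using assms unfolding vector_fields_def by blast
  then show ?thesis by (simp add: Gam_def)
qed

text \<open>The inhomogeneous transformation law of the Christoffel symbols. Over the overlap of two charts
  the coordinate fields of \<open>i\<close> are combinations of those of \<open>j\<close> whose coefficients are the entries of
  the Jacobian; the Leibniz rule, applied to these coefficients, produces the second derivatives.\<close>

lemma Gam_transform:
  assumes "chart_at M i p" "chart_at M j p"
  shows "jac M i j p (Gam i p a b) = Gam j p (jac M i j p a) (jac M i j p b)
    + frechet_derivative (\<lambda>x. jac M i j (cinv M i x) b) (at (cmap M i p)) a"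
proof -
  define U where "U = cdom M i \<inter> cdom M j"
  have ch: "i \<in> charts M" "j \<in> charts M" "p \<in> cdom M i" "p \<in> cdom M j"
    using assms by (auto simp: chart_at_def)
  have U: "openin (mtop M) U" "U \<subseteq> cdom M i" "U \<subseteq> cdom M j" "p \<in> U"
    using ch by (auto simp: U_def intro: openin_cdom openin_Int)
  define f where "f v c q = jac M i j q v \<bullet> c" for v c q
  have f: "smooth_fun M U (f v c)" for v c
    unfolding f_def
    by (rule smooth_funI[OF ch(1) U(1,2)])
      (use ch U smooth_jac[of i j] in \<open>auto intro!: smooth_on_inner open_cmap_image simp: U_def\<close>)
  have ci: "coord_vec M i v \<in> vector_fields M U" and cj: "coord_vec M j v \<in> vector_fields M U" for v
    using ch U by (auto intro!: coord_vec_vector_field)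
  let ?X = "\<lambda>v q. \<Sum>c\<in>Basis. f v c q *\<^sub>R coord_vec M j c q"
  have X: "?X v \<in> vector_fields M U" for v
    by (intro vector_fields_combination U f cj finite_Basis)
  have eq: "coord_vec M i v q = ?X v q" if "q \<in> U" for v q
  proof -
    have q: "chart_at M i q" "chart_at M j q" using that ch by (auto simp: U_def chart_at_def)
    have "coord_vec M i v q = coord_vec M j (coord_vec M i v q j) q"
      by (rule tangent_eq_coord_vec[OF coord_vec_tangent[OF q(1)] q(2)])
    also have "\<dots> = ?X v q"
      unfolding coord_vec_apply[OF q(2), of i v] f_def by (rule coord_vec_combination[OF q(2)])
    finally show ?thesis .
  qed
  have jj: "nab U (coord_vec M j c) (coord_vec M j e) p j = Gam j p c e" for c e
    unfolding Gam_def
    by (rule arg_cong[where f = "\<lambda>t. t j"], rule nab_local) (use U ch ci cj in \<open>auto intro: openin_cdom coord_vec_cdom\<close>)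
  \<comment> \<open>The direction is changed first: there the connection is tensorial. The differentiated field follows
    below and brings in the derivatives of the coefficients.\<close>
  have ij: "nab U (coord_vec M i a) (coord_vec M j e) p j = Gam j p (jac M i j p a) e" for e
  proof -
    have "nab U (coord_vec M i a) (coord_vec M j e) p = nab U (?X a) (coord_vec M j e) p"
      by (rule nab_local) (use U ci cj X eq in auto)
    also have "\<dots> = (\<Sum>c\<in>Basis. f a c p *\<^sub>R nab U (coord_vec M j c) (coord_vec M j e) p)"
      by (intro nab_combination_left U cj f finite_Basis)
    finally show ?thesis
      by (simp add: sum_fun_apply scaleR_fun_def jj Gam_linear_left[OF assms(2), of "jac M i j p a"] f_def)
  qed
  let ?D = "frechet_derivative (\<lambda>x. jac M i j (cinv M i x) b) (at (cmap M i p)) a"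
  have dd: "dir_deriv M (f b e) p (coord_vec M i a p) = ?D \<bullet> e" for e
  proof -
    have "((\<lambda>x. jac M i j (cinv M i x) b) has_derivative
        frechet_derivative (\<lambda>x. jac M i j (cinv M i x) b) (at (cmap M i p))) (at (cmap M i p))"
      using smooth_jac ch by (intro smooth_on_has_derivative[where S = "cmap M i ` U"]) (auto simp: U_def)
    then have "((\<lambda>x. jac M i j (cinv M i x) b \<bullet> e) has_derivative
        (\<lambda>v. frechet_derivative (\<lambda>x. jac M i j (cinv M i x) b) (at (cmap M i p)) v \<bullet> e)) (at (cmap M i p))"
      by (rule has_derivative_inner_left)
    from frechet_derivative_at[OF this, symmetric] show ?thesis
      by (simp add: dir_deriv_chart[OF f U(1,4) assms(1) coord_vec_tangent[OF assms(1)]]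
          coord_vec_self[OF assms(1)] f_def)
  qed
  have "nab U (coord_vec M i a) (coord_vec M i b) p = nab (cdom M i) (coord_vec M i a) (coord_vec M i b) p"
    by (rule nab_local) (use U ch ci in \<open>auto intro: openin_cdom coord_vec_cdom\<close>)
  moreover have "nab (cdom M i) (coord_vec M i a) (coord_vec M i b) p \<in> tangent_space M p"
    using nab_vector_field[OF openin_cdom[OF ch(1)] coord_vec_cdom[OF ch(1)] coord_vec_cdom[OF ch(1)]] ch(3)
    unfolding vector_fields_def by blast
  ultimately have "jac M i j p (Gam i p a b) = nab U (coord_vec M i a) (coord_vec M i b) p j"
    using tangent_transform[OF _ assms] by (simp add: Gam_def)
  also have "nab U (coord_vec M i a) (coord_vec M i b) p = nab U (coord_vec M i a) (?X b) p"
    by (rule nab_local) (use U ci X eq in auto)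
  also have "\<dots> = (\<Sum>e\<in>Basis. dir_deriv M (f b e) p (coord_vec M i a p) *\<^sub>R coord_vec M j e p
      + f b e p *\<^sub>R nab U (coord_vec M i a) (coord_vec M j e) p)"
    by (intro nab_combination_right U ci cj f finite_Basis)
  also have "\<dots> j = (\<Sum>e\<in>Basis. (?D \<bullet> e) *\<^sub>R e)
      + (\<Sum>e\<in>Basis. (jac M i j p b \<bullet> e) *\<^sub>R Gam j p (jac M i j p a) e)"
    by (simp add: sum_fun_apply scaleR_fun_def sum.distrib dd ij coord_vec_self[OF assms(2)] f_def)
  also have "\<dots> = ?D + Gam j p (jac M i j p a) (jac M i j p b)"
    by (simp add: euclidean_representation linear_basis_expansion[OF linear_Gam_right[OF assms(2)], symmetric])
  finally show ?thesis by simp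
qed

lemma christoffel_sum:
  assumes "chart_at M i p"
  shows "(\<Sum>k\<in>Basis. (\<Sum>a\<in>Basis. \<Sum>b\<in>Basis. (y \<bullet> a) * christoffel M nab i p a b k * (x \<bullet> b)) *\<^sub>R k) = Gam i p y x"
proof -
  have "(\<Sum>a\<in>Basis. \<Sum>b\<in>Basis. (y \<bullet> a) * christoffel M nab i p a b k * (x \<bullet> b)) = Gam i p y x \<bullet> k" for k
  proof -
    have "Gam i p y x = (\<Sum>a\<in>Basis. (y \<bullet> a) *\<^sub>R Gam i p a x)"
      by (rule Gam_linear_left[OF assms])
    also have "\<dots> = (\<Sum>a\<in>Basis. (y \<bullet> a) *\<^sub>R (\<Sum>b\<in>Basis. (x \<bullet> b) *\<^sub>R Gam i p a b))"
      by (intro sum.cong refl arg_cong2[where f = scaleR] linear_basis_expansion linear_Gam_right assms)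
    finally show ?thesis
      by (simp add: inner_sum_left sum_distrib_left christoffel_def Gam_def mult_ac)
  qed
  then show ?thesis by (simp add: euclidean_representation)
qed

lemma hlift_apply:
  "chart_at M i (fst u) \<Longrightarrow> hlift M nab u X i = (X i, - Gam i (fst u) (snd u i) (X i))"
  by (simp add: hlift_def christoffel_sum)

end

section \<open>The tangent bundle as a manifold\<close>

text \<open>A set with charts that carries the topology in which the preimages of open sets under the charts
  form a subbase. The tangent bundle arises in this way.\<close>

locale smooth_atlas =
  fixes N :: "('b, 'i, 'f::euclidean_space) mfd"
  assumes mtop: "mtop N = topology_generated_by
      {W. \<exists>i\<in>charts N. \<exists>S. open S \<and> W = {u \<in> cdom N i. cmap N i u \<in> S}}"
    and inj: "i \<in> charts N \<Longrightarrow> inj_on (cmap N i) (cdom N i)"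
    and open_overlap: "i \<in> charts N \<Longrightarrow> j \<in> charts N \<Longrightarrow> open (cmap N i ` (cdom N i \<inter> cdom N j))"
    and smooth_transition: "i \<in> charts N \<Longrightarrow> j \<in> charts N \<Longrightarrow>
      smooth_on (cmap N i ` (cdom N i \<inter> cdom N j)) (transition N i j)"
begin

lemma openin_chart_preimage:
  "i \<in> charts N \<Longrightarrow> open S \<Longrightarrow> openin (mtop N) {u \<in> cdom N i. cmap N i u \<in> S}"
  unfolding mtop by (rule topology_generated_by_Basis) blast

text \<open>Openness can be tested by the images in all charts: for a subbasic set the image in another chart
  is a preimage under a transition map, which is continuous.\<close>

lemma openin_iff:
  "openin (mtop N) W \<longleftrightarrow>
    W \<subseteq> (\<Union>i\<in>charts N. cdom N i) \<and> (\<forall>i\<in>charts N. open (cmap N i ` (W \<inter> cdom N i)))"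
proof (intro iffI conjI ballI)
  assume "openin (mtop N) W"
  then have W: "generate_topology_on
      {W. \<exists>i\<in>charts N. \<exists>S. open S \<and> W = {u \<in> cdom N i. cmap N i u \<in> S}} W"
    unfolding mtop openin_topology_generated_by_iff .
  then show "W \<subseteq> (\<Union>i\<in>charts N. cdom N i)"
    by (induction rule: generate_topology_on.induct) auto
  show "open (cmap N i ` (W \<inter> cdom N i))" if i: "i \<in> charts N" for i
    using W
  proof (induction rule: generate_topology_on.induct)
    case (Int a b)
    have "cmap N i ` ((a \<inter> b) \<inter> cdom N i) = cmap N i ` (a \<inter> cdom N i) \<inter> cmap N i ` (b \<inter> cdom N i)"
      using inj_on_image_Int[OF inj[OF i], of "a \<inter> cdom N i" "b \<inter> cdom N i"] by (simp add: Int_ac)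
    then show ?case using Int by auto
  next
    case (UN K)
    have "cmap N i ` (\<Union> K \<inter> cdom N i) = (\<Union>a\<in>K. cmap N i ` (a \<inter> cdom N i))" by blast
    then show ?case using UN by auto
  next
    case (Basis W)
    then obtain j S where j: "j \<in> charts N" "open S" "W = {u \<in> cdom N j. cmap N j u \<in> S}" by blast
    let ?O = "cmap N i ` (cdom N i \<inter> cdom N j)"
    have "cmap N i ` (W \<inter> cdom N i) = ?O \<inter> transition N i j -` S"
      using inj[OF i] j(3) by (auto simp: transition_def cinv_def)
    moreover have "open (?O \<inter> transition N i j -` S)"
      using i j by (intro continuous_open_preimage smooth_on_continuous smooth_transition open_overlap)
    ultimately show ?case by simp
  qed simp
next
  assume W: "W \<subseteq> (\<Union>i\<in>charts N. cdom N i) \<and> (\<forall>i\<in>charts N. open (cmap N i ` (W \<inter> cdom N i)))"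
  have "u \<in> W" if "i \<in> charts N" "u \<in> cdom N i" "w \<in> W" "w \<in> cdom N i" "cmap N i u = cmap N i w" for i u w
    using inj_onD[OF inj[OF that(1)] that(5) that(2,4)] that(3) by simp
  then have "W = (\<Union>i\<in>charts N. {u \<in> cdom N i. cmap N i u \<in> cmap N i ` (W \<inter> cdom N i)})"
    using W by blast
  moreover have "openin (mtop N) (\<Union>i\<in>charts N. {u \<in> cdom N i. cmap N i u \<in> cmap N i ` (W \<inter> cdom N i)})"
    using W by (intro openin_Union) (auto intro: openin_chart_preimage)
  ultimately show "openin (mtop N) W" by simp
qed

lemma topspace_eq: "topspace (mtop N) = (\<Union>i\<in>charts N. cdom N i)"
proof
  show "topspace (mtop N) \<subseteq> (\<Union>i\<in>charts N. cdom N i)"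
    using openin_iff[of "topspace (mtop N)"] by simp
  have "openin (mtop N) (\<Union>i\<in>charts N. cdom N i)"
    using openin_chart_preimage[of _ UNIV] by (intro openin_Union) auto
  then show "(\<Union>i\<in>charts N. cdom N i) \<subseteq> topspace (mtop N)"
    by (rule openin_subset)
qed

lemma openin_cdom: "i \<in> charts N \<Longrightarrow> openin (mtop N) (cdom N i)"
  using openin_chart_preimage[of i UNIV] by simp

lemma homeomorphic_cmap:
  assumes i: "i \<in> charts N"
  shows "homeomorphic_map (subtopology (mtop N) (cdom N i)) (top_of_set (cmap N i ` cdom N i)) (cmap N i)"
proof (rule bijective_open_imp_homeomorphic_map)
  have top: "topspace (subtopology (mtop N) (cdom N i)) = cdom N i"
    using openin_subset[OF openin_cdom[OF i]] by (simp add: inf_absorb2)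
  have op: "open (cmap N i ` cdom N i)"
    using open_overlap[OF i i] by simp
  show "continuous_map (subtopology (mtop N) (cdom N i)) (top_of_set (cmap N i ` cdom N i)) (cmap N i)"
    unfolding continuous_map_def top
  proof (intro conjI allI impI)
    fix S assume "openin (top_of_set (cmap N i ` cdom N i)) S"
    then have "open S" using op by (simp add: openin_open_eq)
    then show "openin (subtopology (mtop N) (cdom N i)) {u \<in> cdom N i. cmap N i u \<in> S}"
      using openin_chart_preimage[OF i] openin_cdom[OF i] by (simp add: openin_open_subtopology)
  qed simp
  show "open_map (subtopology (mtop N) (cdom N i)) (top_of_set (cmap N i ` cdom N i)) (cmap N i)"
    unfolding open_map_def
  proof (intro allI impI)
    fix W assume "openin (subtopology (mtop N) (cdom N i)) W"
    then have W: "openin (mtop N) W" "W \<subseteq> cdom N i"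
      using openin_cdom[OF i] by (simp_all add: openin_open_subtopology)
    then have "open (cmap N i ` W)"
      using openin_iff[of W] i by (metis inf_absorb1)
    then show "openin (top_of_set (cmap N i ` cdom N i)) (cmap N i ` W)"
      using op W(2) by (auto simp: openin_open_eq)
  qed
  show "inj_on (cmap N i) (topspace (subtopology (mtop N) (cdom N i)))"
    using inj[OF i] top by simp
  show "cmap N i ` topspace (subtopology (mtop N) (cdom N i)) = topspace (top_of_set (cmap N i ` cdom N i))"
    using top by simp
qed

text \<open>The atlas may be uncountable, but countably many charts that cover the space, each with a countable
  base of its image, already provide a countable base.\<close>

lemma second_countable_of_countable_cover:
  assumes "countable I" "I \<subseteq> charts N" "(\<Union>i\<in>charts N. cdom N i) = (\<Union>i\<in>I. cdom N i)"
  shows "second_countable (mtop N)"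
proof -
  obtain B :: "'f set set" where B: "countable B" "\<And>S. S \<in> B \<Longrightarrow> open S"
    "\<And>S. open S \<Longrightarrow> \<exists>U. U \<subseteq> B \<and> S = \<Union>U"
    using univ_second_countable by blast
  let ?W = "\<lambda>(i, S). {u \<in> cdom N i. cmap N i u \<in> S}"
  show ?thesis
    unfolding second_countable_def
  proof (intro exI[of _ "?W ` (I \<times> B)"] conjI ballI allI impI)
    show "countable (?W ` (I \<times> B))"
      using assms(1) B(1) by blast
    show "openin (mtop N) V" if "V \<in> ?W ` (I \<times> B)" for V
      using that assms(2) B(2) openin_chart_preimage by auto
    show "\<exists>V\<in>?W ` (I \<times> B). u \<in> V \<and> V \<subseteq> U" if "openin (mtop N) U \<and> u \<in> U" for U u
    proof -
      have u: "openin (mtop N) U" "u \<in> U" using that by auto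
      then have "u \<in> (\<Union>i\<in>I. cdom N i)"
        using openin_subset[OF u(1)] topspace_eq assms(3) by blast
      then obtain i where i: "i \<in> I" "u \<in> cdom N i" by blast
      have iN: "i \<in> charts N" using i assms(2) by blast
      have "open (cmap N i ` (U \<inter> cdom N i))"
        using u(1)[unfolded openin_iff] iN by simp
      then obtain S where S: "S \<in> B" "cmap N i u \<in> S" "S \<subseteq> cmap N i ` (U \<inter> cdom N i)"
        using B(3)[of "cmap N i ` (U \<inter> cdom N i)"] i u(2) by blast
      have "v \<in> U" if v: "v \<in> cdom N i" "cmap N i v \<in> S" for v
      proof -
        obtain w where "w \<in> U" "w \<in> cdom N i" "cmap N i v = cmap N i w"
          using v(2) S(3) by blast
        then show ?thesis using inj_onD[OF inj[OF iN] _ v(1)] by metis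
      qed
      then have "?W (i, S) \<subseteq> U" by auto
      moreover have "u \<in> ?W (i, S)" using i S by simp
      ultimately show ?thesis using i S by blast
    qed
  qed
qed

lemma smooth_manifoldI:
  assumes "countable I" "I \<subseteq> charts N" "(\<Union>i\<in>charts N. cdom N i) = (\<Union>i\<in>I. cdom N i)"
    and "Hausdorff_space (mtop N)"
  shows "smooth_manifold N DIM('f)"
  unfolding smooth_manifold_def
  using second_countable_of_countable_cover[OF assms(1-3)] assms(4) topspace_eq openin_cdom
    homeomorphic_cmap smooth_transition open_overlap
  by (metis Int_absorb)

end

context smooth_mfd
begin

abbreviation "TM \<equiv> tangent_bundle M"

lemma TM_simps:
  "charts TM = charts M"
  "cdom TM i = {(p, y). p \<in> cdom M i \<and> y \<in> tangent_space M p}"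
  "cmap TM i u = (cmap M i (fst u), snd u i)"
  by (simp_all add: tangent_bundle_def split_beta)

lemma TM_chart_at: "chart_at TM i u \<longleftrightarrow> chart_at M i (fst u) \<and> snd u \<in> tangent_space M (fst u)"
  by (auto simp: chart_at_def TM_simps)

lemma TM_cmap_image:
  assumes "i \<in> charts M" "V \<subseteq> cdom M i"
  shows "cmap TM i ` {(p, y). p \<in> V \<and> y \<in> tangent_space M p} = cmap M i ` V \<times> UNIV"
proof -
  have "(cmap M i p, a) \<in> cmap TM i ` {(p, y). p \<in> V \<and> y \<in> tangent_space M p}" if "p \<in> V" for p a
    by (rule image_eqI[where x = "(p, coord_vec M i a p)"])
      (use that assms in \<open>auto simp: TM_simps chart_at_def coord_vec_self coord_vec_tangent subset_iff\<close>)
  then show ?thesis by (auto simp: TM_simps)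
qed

lemma TM_inj_cmap:
  assumes "i \<in> charts M"
  shows "inj_on (cmap TM i) (cdom TM i)"
proof (rule inj_onI)
  fix u w assume u: "u \<in> cdom TM i" and w: "w \<in> cdom TM i" and eq: "cmap TM i u = cmap TM i w"
  have fst: "fst u = fst w"
    using u w eq inj_onD[OF inj_cmap[OF assms]] by (auto simp: TM_simps)
  have "snd u = snd w"
    by (rule tangent_eqI[where p = "fst u" and i = i])
      (use u w eq fst assms in \<open>auto simp: TM_simps chart_at_def\<close>)
  with fst show "u = w" by (simp add: prod_eq_iff)
qed

lemma TM_cinv:
  assumes "i \<in> charts M" "p \<in> cdom M i"
  shows "cinv TM i (cmap M i p, a) = (p, coord_vec M i a p)"
  unfolding cinv_def
  by (rule inv_into_f_eq[OF TM_inj_cmap[OF assms(1)]])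
    (use assms in \<open>auto simp: TM_simps chart_at_def coord_vec_self coord_vec_tangent\<close>)

lemma TM_transition:
  assumes "chart_at M i p" "chart_at M j p"
  shows "transition TM i j (cmap M i p, a) = (cmap M j p, jac M i j p a)"
  using assms by (auto simp: transition_def TM_cinv TM_simps chart_at_def coord_vec_apply)

lemma TM_overlap:
  assumes "i \<in> charts M"
  shows "cmap TM i ` (cdom TM i \<inter> cdom TM j) = cmap M i ` (cdom M i \<inter> cdom M j) \<times> UNIV"
proof -
  have "cdom TM i \<inter> cdom TM j = {(p, y). p \<in> cdom M i \<inter> cdom M j \<and> y \<in> tangent_space M p}"
    by (auto simp: TM_simps)
  then show ?thesis using TM_cmap_image[OF assms, of "cdom M i \<inter> cdom M j"] by simp
qed

lemma TM_smooth_transition: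
  assumes "i \<in> charts M" "j \<in> charts M"
  shows "smooth_on (cmap TM i ` (cdom TM i \<inter> cdom TM j)) (transition TM i j)"
proof -
  let ?O = "cmap M i ` (cdom M i \<inter> cdom M j)"
  let ?S = "?O \<times> (UNIV :: 'e set)"
  have O: "open ?O" "open ?S"
    using assms by (auto intro!: open_overlap openin_cdom open_Times)
  have fst: "smooth_on ?S (\<lambda>z. h (fst z))" if "smooth_on ?O h" for h :: "'e \<Rightarrow> 'e"
    by (rule smooth_on_compose[OF O(2,1) _ _ that]) (auto intro!: smooth_on_fst smooth_on_ident O)
  have "smooth_on ?S (\<lambda>z. jac M i j (cinv M i (fst z)) (snd z))"
  proof (rule smooth_on_linear_combination[where L = "\<lambda>z. jac M i j (cinv M i (fst z))"])
    show "linear (jac M i j (cinv M i (fst z)))" if "z \<in> ?S" for z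
      using that assms by (auto intro!: linear_jac simp: chart_at_def)
    show "smooth_on ?S (\<lambda>z. jac M i j (cinv M i (fst z)) b)" for b
      by (rule fst[OF smooth_jac[OF assms]])
  qed (use O in \<open>auto intro!: smooth_on_snd smooth_on_ident\<close>)
  then have "smooth_on ?S (\<lambda>z. (transition M i j (fst z), jac M i j (cinv M i (fst z)) (snd z)))"
    by (intro smooth_on_Pair fst smooth_transition assms O)
  then have "smooth_on ?S (transition TM i j)"
    by (rule smooth_on_cong[OF O(2)])
      (use assms in \<open>auto simp: TM_transition transition_cmap chart_at_def\<close>)
  then show ?thesis by (simp add: TM_overlap[OF assms(1)])
qed

lemma TM_smooth_atlas: "smooth_atlas TM"
proof
  show "mtop TM = topology_generated_by
      {W. \<exists>i\<in>charts TM. \<exists>S. open S \<and> W = {u \<in> cdom TM i. cmap TM i u \<in> S}}"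
    by (simp add: tangent_bundle_def case_prod_unfold conj_assoc)
  show "open (cmap TM i ` (cdom TM i \<inter> cdom TM j))" if "i \<in> charts TM" "j \<in> charts TM" for i j
    using that by (simp add: TM_simps(1) TM_overlap open_Times open_overlap openin_cdom)
qed (simp_all only: TM_simps(1) TM_inj_cmap TM_smooth_transition)

lemma TM_topspace: "topspace (mtop TM) = {(p, y). p \<in> topspace (mtop M) \<and> y \<in> tangent_space M p}"
  unfolding smooth_atlas.topspace_eq[OF TM_smooth_atlas]
  using smooth_manifold by (fastforce simp: TM_simps smooth_manifold_def)

lemma TM_openin_over:
  assumes "openin (mtop M) U"
  shows "openin (mtop TM) {(p, y). p \<in> U \<and> y \<in> tangent_space M p}" (is "openin _ ?W")
  unfolding smooth_atlas.openin_iff[OF TM_smooth_atlas]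
proof (intro conjI ballI)
  show "?W \<subseteq> (\<Union>i\<in>charts TM. cdom TM i)"
    using openin_subset[OF assms]
    by (auto simp flip: smooth_atlas.topspace_eq[OF TM_smooth_atlas] simp: TM_topspace)
  fix i assume i: "i \<in> charts TM"
  have "?W \<inter> cdom TM i = {(p, y). p \<in> U \<inter> cdom M i \<and> y \<in> tangent_space M p}"
    by (auto simp: TM_simps)
  then show "open (cmap TM i ` (?W \<inter> cdom TM i))"
    using i TM_cmap_image[of i "U \<inter> cdom M i"] open_overlap[OF assms, of i]
    by (simp add: TM_simps open_Times)
qed

text \<open>Tangent vectors at different points are separated by open sets of the base, tangent vectors at
  the same point by their components in a chart.\<close>

lemma TM_Hausdorff: "Hausdorff_space (mtop TM)"
  unfolding Hausdorff_space_def
proof (intro allI impI)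
  fix u w assume "u \<in> topspace (mtop TM) \<and> w \<in> topspace (mtop TM) \<and> u \<noteq> w"
  then have u: "fst u \<in> topspace (mtop M)" "snd u \<in> tangent_space M (fst u)"
    and w: "fst w \<in> topspace (mtop M)" "snd w \<in> tangent_space M (fst w)" and "u \<noteq> w"
    by (auto simp: TM_topspace)
  show "\<exists>U V. openin (mtop TM) U \<and> openin (mtop TM) V \<and> u \<in> U \<and> w \<in> V \<and> disjnt U V"
  proof (cases "fst u = fst w")
    case False
    have "Hausdorff_space (mtop M)" using smooth_manifold by (simp add: smooth_manifold_def)
    then obtain U V where "openin (mtop M) U" "openin (mtop M) V" "fst u \<in> U" "fst w \<in> V" "disjnt U V"
      using u(1) w(1) False unfolding Hausdorff_space_def by blast
    then show ?thesis
      using TM_openin_over[of U] TM_openin_over[of V] u w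
      by (intro exI[of _ "{(p, y). p \<in> U \<and> y \<in> tangent_space M p}"]
          exI[of _ "{(p, y). p \<in> V \<and> y \<in> tangent_space M p}"]) (auto simp: disjnt_def split_beta)
  next
    case True
    obtain i where i: "chart_at M i (fst u)" using chart_at_exists[OF u(1)] by blast
    have "snd u \<noteq> snd w" using True \<open>u \<noteq> w\<close> by (simp add: prod_eq_iff)
    then have "snd u i \<noteq> snd w i"
      using tangent_eqI[OF u(2) _ i] w(2) True by metis
    then obtain A B where AB: "open A" "open B" "snd u i \<in> A" "snd w i \<in> B" "A \<inter> B = {}"
      using hausdorff[of "snd u i" "snd w i"] by blast
    have iN: "i \<in> charts TM" using i by (simp add: TM_simps chart_at_def)
    show ?thesis
    proof (intro exI conjI)
      show "openin (mtop TM) {v \<in> cdom TM i. cmap TM i v \<in> UNIV \<times> A}"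
        "openin (mtop TM) {v \<in> cdom TM i. cmap TM i v \<in> UNIV \<times> B}"
        using AB by (auto intro!: smooth_atlas.openin_chart_preimage[OF TM_smooth_atlas iN] open_Times)
    qed (use AB i u w True in \<open>auto simp: TM_simps chart_at_def disjnt_def split_beta\<close>)
  qed
qed

text \<open>The base is a Lindelof space, so that countably many of its charts cover it; the induced charts
  then cover the bundle.\<close>

lemma TM_smooth_manifold: "smooth_manifold TM (2 * d)"
proof -
  have "Lindelof_space (mtop M)"
    using smooth_manifold by (intro second_countable_imp_Lindelof_space) (simp add: smooth_manifold_def)
  moreover have "U \<in> cdom M ` charts M \<Longrightarrow> openin (mtop M) U" for U
    using openin_cdom by blast
  moreover have "\<Union>(cdom M ` charts M) = topspace (mtop M)"
    using smooth_manifold by (simp add: smooth_manifold_def)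
  ultimately obtain C where C: "countable C" "C \<subseteq> cdom M ` charts M" "\<Union>C = topspace (mtop M)"
    using Lindelof_spaceD[of "mtop M" "cdom M ` charts M"] by metis
  then obtain I where I: "countable I" "I \<subseteq> charts M" "C = cdom M ` I"
    using countable_subset_image[of C "cdom M" "charts M"] by auto
  have "(\<Union>i\<in>charts M. cdom M i) = (\<Union>i\<in>I. cdom M i)"
    using C(3) I(3) smooth_manifold by (auto simp: smooth_manifold_def)
  then have "(\<Union>i\<in>charts TM. cdom TM i) = (\<Union>i\<in>I. cdom TM i)"
    by (auto simp: TM_simps)
  then have "smooth_manifold TM DIM('e \<times> 'e)"
    using I TM_Hausdorff by (intro smooth_atlas.smooth_manifoldI[OF TM_smooth_atlas]) (auto simp: TM_simps)
  moreover have "DIM('e \<times> 'e) = 2 * d"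
    using smooth_manifold by (simp add: smooth_manifold_def)
  ultimately show ?thesis by simp
qed

text \<open>The second component of a transition map of the bundle is the Jacobian of the base applied to the
  fibre coordinate; hence its derivative along the base is a second derivative of the transition map.\<close>

lemma TM_jac:
  assumes "chart_at TM i u" "chart_at TM j u"
  shows "jac TM i j u (v, w) = (jac M i j (fst u) v,
    frechet_derivative (\<lambda>x. jac M i j (cinv M i x) (snd u i)) (at (cmap M i (fst u))) v + jac M i j (fst u) w)"
proof -
  define p y where "p = fst u" and "y = snd u i"
  have ch: "chart_at M i p" "chart_at M j p" "i \<in> charts M" "j \<in> charts M" "p \<in> cdom M i" "p \<in> cdom M j"
    using assms by (auto simp: TM_simps chart_at_def p_def)
  let ?O = "cmap M i ` (cdom M i \<inter> cdom M j)" and ?x = "cmap M i p"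
  have O: "open ?O" "open (?O \<times> (UNIV :: 'e set))" "?x \<in> ?O"
    using ch by (auto intro!: open_overlap openin_cdom open_Times)
  let ?J = "\<lambda>e x. jac M i j (cinv M i x) e"
  define D where "D e = frechet_derivative (?J e) (at ?x)" for e
  have D: "(?J e has_derivative D e) (at ?x)" for e
    unfolding D_def by (rule smooth_on_has_derivative[OF smooth_jac[OF ch(3,4)] O(3)])
  have expand: "?J a x = (\<Sum>e\<in>Basis. (a \<bullet> e) *\<^sub>R ?J e x)" if "x \<in> ?O" for a x
    using that ch by (intro linear_basis_expansion linear_jac) (auto simp: chart_at_def)
  have "(?J y has_derivative (\<lambda>v. \<Sum>e\<in>Basis. (y \<bullet> e) *\<^sub>R D e v)) (at ?x)"
    by (rule has_derivative_transform_within_open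
        [OF has_derivative_sum[OF has_derivative_scaleR_right[OF D]] O(1,3) expand[symmetric]])
  from frechet_derivative_at[OF this, symmetric]
  have Dy: "D y v = (\<Sum>e\<in>Basis. (y \<bullet> e) *\<^sub>R D e v)" for v
    unfolding D_def[of y] by (rule fun_cong)
  have "((\<lambda>z. \<Sum>e\<in>Basis. (snd z \<bullet> e) *\<^sub>R ?J e (fst z)) has_derivative
      (\<lambda>h. \<Sum>e\<in>Basis. (snd (?x, y) \<bullet> e) *\<^sub>R D e (fst h) + (snd h \<bullet> e) *\<^sub>R ?J e (fst (?x, y)))) (at (?x, y))"
  proof (intro has_derivative_sum has_derivative_scaleR)
    fix e :: 'e
    show "((\<lambda>z. snd z \<bullet> e) has_derivative (\<lambda>h. snd h \<bullet> e)) (at (?x, y))"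
      by (intro has_derivative_inner_left has_derivative_snd has_derivative_ident)
    show "((\<lambda>z. ?J e (fst z)) has_derivative (\<lambda>h. D e (fst h))) (at (?x, y))"
      by (rule has_derivative_compose[OF has_derivative_fst[OF has_derivative_ident]]) (simp add: D)
  qed
  moreover have "((\<lambda>z. transition M i j (fst z)) has_derivative (\<lambda>h. jac M i j p (fst h))) (at (?x, y))"
    by (rule has_derivative_compose[OF has_derivative_fst[OF has_derivative_ident]])
      (simp add: transition_has_derivative[OF ch(1,2)])
  ultimately have "((\<lambda>z. (transition M i j (fst z), \<Sum>e\<in>Basis. (snd z \<bullet> e) *\<^sub>R ?J e (fst z))) has_derivative
      (\<lambda>h. (jac M i j p (fst h),
        \<Sum>e\<in>Basis. (snd (?x, y) \<bullet> e) *\<^sub>R D e (fst h) + (snd h \<bullet> e) *\<^sub>R ?J e (fst (?x, y))))) (at (?x, y))"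
    by (intro has_derivative_Pair)
  then have "(transition TM i j has_derivative (\<lambda>h. (jac M i j p (fst h),
        \<Sum>e\<in>Basis. (snd (?x, y) \<bullet> e) *\<^sub>R D e (fst h) + (snd h \<bullet> e) *\<^sub>R ?J e (fst (?x, y))))) (at (?x, y))"
  proof (rule has_derivative_transform_within_open[OF _ O(2)])
    show "(transition M i j (fst z), \<Sum>e\<in>Basis. (snd z \<bullet> e) *\<^sub>R ?J e (fst z)) = transition TM i j z"
      if zO: "z \<in> ?O \<times> UNIV" for z
    proof -
      obtain q where q: "fst z = cmap M i q" "q \<in> cdom M i" "q \<in> cdom M j"
        using zO by auto
      then obtain a where z: "z = (cmap M i q, a)"
        by (metis prod.collapse)
      show ?thesis
        using z q ch expand[of "cmap M i q" a] by (simp add: TM_transition chart_at_def transition_cmap)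
    qed
  qed (use O(3) in simp)
  from frechet_derivative_at[OF this, symmetric]
  have "jac TM i j u (v, w) = (jac M i j p v,
      (\<Sum>e\<in>Basis. (y \<bullet> e) *\<^sub>R D e v) + (\<Sum>e\<in>Basis. (w \<bullet> e) *\<^sub>R jac M i j p e))"
    using ch by (simp add: TM_simps p_def[symmetric] y_def[symmetric] sum.distrib)
  then show ?thesis
    using Dy linear_basis_expansion[OF linear_jac[OF ch(1,2)], of w] by (simp add: D_def p_def y_def)
qed

end

section \<open>Horizontal and vertical lifts\<close>

context torsion_free_connection
begin

sublocale TM: smooth_mfd "tangent_bundle M" "2 * d"
  by standard (rule TM_smooth_manifold)

text \<open>For \<open>u\<close> over \<open>p\<close> this map identifies two copies of the tangent space at \<open>p\<close> with the tangent space
  of the bundle at \<open>u\<close>; the tensor fields on the bundle are all defined through its inverse.\<close>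

definition lift :: "'a \<times> ('i \<Rightarrow> 'e) \<Rightarrow> ('i \<Rightarrow> 'e) \<Rightarrow> ('i \<Rightarrow> 'e) \<Rightarrow> 'i \<Rightarrow> 'e \<times> 'e" where
  "lift u X Y = hlift M nab u X + vlift u Y"

lemma linear_hlift: "linear (hlift M nab u)"
proof (rule linearI)
  fix X Y :: "'i \<Rightarrow> 'e" and r :: real
  show "hlift M nab u (X + Y) = hlift M nab u X + hlift M nab u Y"
  proof
    fix i
    show "hlift M nab u (X + Y) i = (hlift M nab u X + hlift M nab u Y) i"
    proof (cases "chart_at M i (fst u)")
      case True
      then show ?thesis
        using linear_add[OF linear_Gam_right[OF True], of "snd u i" "X i" "Y i"] by (simp add: hlift_apply)
    qed (simp add: hlift_def)
  qed
  show "hlift M nab u (r *\<^sub>R X) = r *\<^sub>R hlift M nab u X"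
  proof
    fix i
    show "hlift M nab u (r *\<^sub>R X) i = (r *\<^sub>R hlift M nab u X) i"
    proof (cases "chart_at M i (fst u)")
      case True
      then show ?thesis
        using linear_scale[OF linear_Gam_right[OF True], of "snd u i" r "X i"]
        by (simp add: hlift_apply scaleR_fun_def)
    qed (simp add: hlift_def scaleR_fun_def)
  qed
qed

lemma linear_vlift: "linear (vlift u)"
  by (rule linearI) (auto simp: vlift_def scaleR_fun_def fun_eq_iff)

lemma lift_add: "lift u X Y + lift u X' Y' = lift u (X + X') (Y + Y')"
  by (simp add: lift_def linear_add[OF linear_hlift] linear_add[OF linear_vlift] add_ac del: plus_fun_apply)

lemma lift_scale: "c *\<^sub>R lift u X Y = lift u (c *\<^sub>R X) (c *\<^sub>R Y)"
  by (simp add: lift_def linear_scale[OF linear_hlift] linear_scale[OF linear_vlift] scaleR_add_right)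

lemma lift_minus: "- lift u X Y = lift u (- X) (- Y)"
  using lift_scale[of "-1" u X Y] by simp

lemma lift_apply:
  "chart_at M i (fst u) \<Longrightarrow> lift u X Y i = (X i, Y i - Gam i (fst u) (snd u i) (X i))"
  by (simp add: lift_def hlift_apply vlift_def)

lemma vlift_tangent:
  assumes "u \<in> topspace (mtop TM)" "Y \<in> tangent_space M (fst u)"
  shows "vlift u Y \<in> tangent_space TM u"
proof (rule TM.tangentI)
  fix i assume "\<not> chart_at TM i u"
  then have "\<not> chart_at M i (fst u)" using assms(1) by (auto simp: TM_chart_at TM_topspace)
  then show "vlift u Y i = 0" by (simp add: vlift_def tangent_padding[OF assms(2)] zero_prod_def)
next
  fix i j assume ij: "chart_at TM i u" "chart_at TM j u"
  then have c: "chart_at M i (fst u)" "chart_at M j (fst u)" by (auto simp: TM_chart_at)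
  let ?F = "\<lambda>x. jac M i j (cinv M i x) (snd u i)"
  have "smooth_on (cmap M i ` (cdom M i \<inter> cdom M j)) ?F"
    using c by (intro smooth_jac) (auto simp: chart_at_def)
  then have "linear (frechet_derivative ?F (at (cmap M i (fst u))))"
    by (rule smooth_on_linear_derivative) (use c in \<open>auto simp: chart_at_def\<close>)
  then show "vlift u Y j = jac TM i j u (vlift u Y i)"
    using tangent_transform[OF assms(2) c]
    by (simp add: vlift_def TM_jac[OF ij] linear_0 linear_0[OF linear_jac[OF c]])
qed

text \<open>That the coordinate formula for the horizontal lift defines a tangent vector is the
  transformation law of the Christoffel symbols: the second derivative in the Jacobian of the bundle
  is the inhomogeneous term of that law. With \<open>y\<close> the vector at which \<open>X\<close> is lifted, the Jacobian
  differentiates the image of \<open>y\<close> in the direction \<open>X\<close>, and so does the law for \<open>\<Gamma>(X, y)\<close>, whereas the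
  lift contains \<open>\<Gamma>(y, X)\<close>; the vanishing of the torsion exchanges the two.\<close>

lemma hlift_tangent:
  assumes "u \<in> topspace (mtop TM)" "X \<in> tangent_space M (fst u)"
  shows "hlift M nab u X \<in> tangent_space TM u"
proof (rule TM.tangentI)
  fix i assume "\<not> chart_at TM i u"
  then have "\<not> chart_at M i (fst u)" using assms(1) by (auto simp: TM_chart_at TM_topspace)
  then show "hlift M nab u X i = 0" by (simp add: hlift_def)
next
  fix i j assume ij: "chart_at TM i u" "chart_at TM j u"
  then have c: "chart_at M i (fst u)" "chart_at M j (fst u)" and y: "snd u \<in> tangent_space M (fst u)"
    by (auto simp: TM_chart_at)
  let ?D = "frechet_derivative (\<lambda>x. jac M i j (cinv M i x) (snd u i)) (at (cmap M i (fst u))) (X i)"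
  have "jac M i j (fst u) (Gam i (fst u) (snd u i) (X i)) = jac M i j (fst u) (Gam i (fst u) (X i) (snd u i))"
    by (simp only: Gam_sym[OF c(1), of "snd u i"])
  also have "\<dots> = Gam j (fst u) (jac M i j (fst u) (X i)) (jac M i j (fst u) (snd u i)) + ?D"
    by (rule Gam_transform[OF c])
  also have "\<dots> = Gam j (fst u) (X j) (snd u j) + ?D"
    by (simp only: tangent_transform[OF assms(2) c] tangent_transform[OF y c])
  also have "\<dots> = Gam j (fst u) (snd u j) (X j) + ?D"
    by (simp only: Gam_sym[OF c(2), of "X j"])
  finally show "hlift M nab u X j = jac TM i j u (hlift M nab u X i)"
    using tangent_transform[OF assms(2) c]
    by (simp add: hlift_apply[OF c(1)] hlift_apply[OF c(2)] TM_jac[OF ij] linear_neg[OF linear_jac[OF c]])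
qed

lemma lift_tangent:
  "u \<in> topspace (mtop TM) \<Longrightarrow> X \<in> tangent_space M (fst u) \<Longrightarrow> Y \<in> tangent_space M (fst u) \<Longrightarrow>
    lift u X Y \<in> tangent_space TM u"
  unfolding lift_def
  by (intro subspace_add[OF TM.subspace_tangent_space] hlift_tangent vlift_tangent)

lemma TM_chart_obtain:
  assumes "u \<in> topspace (mtop TM)"
  obtains i where "chart_at TM i u" "chart_at M i (fst u)"
  using TM.chart_at_exists[OF assms] by (auto simp: TM_chart_at)

lemma lift_inject:
  assumes "u \<in> topspace (mtop TM)" "X \<in> tangent_space M (fst u)" "Y \<in> tangent_space M (fst u)"
    "X' \<in> tangent_space M (fst u)" "Y' \<in> tangent_space M (fst u)" "lift u X Y = lift u X' Y'"
  shows "X = X' \<and> Y = Y'"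
proof -
  obtain i where i: "chart_at M i (fst u)" using TM_chart_obtain[OF assms(1)] .
  have "lift u X Y i = lift u X' Y' i" using assms(6) by simp
  then have "X i = X' i \<and> Y i = Y' i" by (auto simp: lift_apply[OF i])
  then show ?thesis using tangent_eqI[OF _ _ i] assms by blast
qed

text \<open>Explicit form of the decomposition into lifts: in a chart the horizontal part has the base components
  of \<open>\<xi>\<close>, and the vertical part is what its horizontal lift leaves over in the fibre components.\<close>

lemma lift_in_chart:
  assumes "chart_at TM i u" "\<xi> \<in> tangent_space TM u"
  shows "\<xi> = lift u (coord_vec M i (fst (\<xi> i)) (fst u))
    (coord_vec M i (snd (\<xi> i) + Gam i (fst u) (snd u i) (fst (\<xi> i))) (fst u))" (is "_ = ?l")
proof (rule TM.tangent_eqI[OF assms(2) _ assms(1)])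
  have c: "chart_at M i (fst u)" using assms(1) by (simp add: TM_chart_at)
  show "?l \<in> tangent_space TM u"
    by (intro lift_tangent coord_vec_tangent c TM.chart_at_topspace[OF assms(1)])
  show "\<xi> i = ?l i"
    by (simp add: lift_apply[OF c] coord_vec_self[OF c])
qed

lemma lift_cases:
  assumes "u \<in> topspace (mtop TM)" "\<xi> \<in> tangent_space TM u"
  obtains X Y where "X \<in> tangent_space M (fst u)" "Y \<in> tangent_space M (fst u)" "\<xi> = lift u X Y"
proof -
  obtain i where i: "chart_at TM i u" "chart_at M i (fst u)" using TM_chart_obtain[OF assms(1)] .
  show ?thesis
    by (rule that[OF coord_vec_tangent[OF i(2)] coord_vec_tangent[OF i(2)] lift_in_chart[OF i(1) assms(2)]])
qed

lemma hv_parts_lift: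
  assumes "u \<in> topspace (mtop TM)" "X \<in> tangent_space M (fst u)" "Y \<in> tangent_space M (fst u)"
  shows "hv_parts M nab u (lift u X Y) = (X, Y)"
  unfolding hv_parts_def lift_def[symmetric]
proof (rule the_equality)
  fix XY
  assume *: "fst XY \<in> tangent_space M (fst u) \<and> snd XY \<in> tangent_space M (fst u) \<and>
    lift u X Y = lift u (fst XY) (snd XY)"
  have "X = fst XY \<and> Y = snd XY"
    by (rule lift_inject[OF assms]) (use * in auto)
  then show "XY = (X, Y)" by simp
qed (use assms in auto)

lemma lift_J1_lift:
  assumes "u \<in> topspace (mtop TM)" "X \<in> tangent_space M (fst u)" "Y \<in> tangent_space M (fst u)"
  shows "lift_J1 M nab u (lift u X Y) = lift u (- Y) X"
  using linear_neg[OF linear_hlift, of u Y]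
  unfolding lift_J1_def hv_parts_lift[OF assms] by (simp add: lift_def)

lemma lift_J2_lift:
  assumes "u \<in> topspace (mtop TM)" "X \<in> tangent_space M (fst u)" "Y \<in> tangent_space M (fst u)"
  shows "lift_J2 M nab J u (lift u X Y) = lift u (J (fst u) Y) (J (fst u) X)"
  unfolding lift_J2_def hv_parts_lift[OF assms] by (simp add: lift_def add.commute)

lemma sasaki_lift:
  assumes "u \<in> topspace (mtop TM)" "X \<in> tangent_space M (fst u)" "Y \<in> tangent_space M (fst u)"
    "X' \<in> tangent_space M (fst u)" "Y' \<in> tangent_space M (fst u)"
  shows "sasaki M nab g u (lift u X Y) (lift u X' Y') = g (fst u) X X' + g (fst u) Y Y'"
  by (simp add: sasaki_def hv_parts_lift[OF assms(1-3)] hv_parts_lift[OF assms(1,4,5)])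

end

section \<open>Smoothness of the lifted structures\<close>

context smooth_mfd
begin

lemma smooth_at_base:
  fixes x :: "'g::euclidean_space \<Rightarrow> 'e" and F :: "'e \<Rightarrow> 'h::real_normed_vector"
  assumes "i \<in> charts M" "open S" "smooth_on S x" "x ` S \<subseteq> cmap M i ` cdom M i"
    and "smooth_on (cmap M i ` cdom M i) F"
  shows "smooth_on S (\<lambda>z. F (x z))"
  by (rule smooth_on_compose[OF assms(2) open_cmap_cdom[OF assms(1)] assms(4,3,5)])

lemma smooth_endomorphism_at:
  fixes x :: "'g::euclidean_space \<Rightarrow> 'e"
  assumes J: "smooth_endomorphism M J"
    and x: "i \<in> charts M" "open S" "smooth_on S x" "x ` S \<subseteq> cmap M i ` cdom M i"
    and A: "smooth_on S A"
  shows "smooth_on S (\<lambda>z. J (cinv M i (x z)) (coord_vec M i (A z) (cinv M i (x z))) i)"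
proof (rule smooth_on_linear_combination[where L = "\<lambda>z a. J (cinv M i (x z)) (coord_vec M i a (cinv M i (x z))) i"])
  show "smooth_on S (\<lambda>z. J (cinv M i (x z)) (coord_vec M i b (cinv M i (x z))) i)" if "b \<in> Basis" for b
    by (rule smooth_at_base[OF x J[unfolded smooth_endomorphism_def, THEN conjunct2, rule_format, OF x(1) that]])
  fix z assume "z \<in> S"
  then have c: "chart_at M i (cinv M i (x z))"
    using x(1,4) by (auto simp: chart_at_def)
  have T: "coord_vec M i a (cinv M i (x z)) \<in> tangent_space M (cinv M i (x z))" for a
    by (rule coord_vec_tangent[OF c])
  have J': "J (cinv M i (x z)) (v + w) = J (cinv M i (x z)) v + J (cinv M i (x z)) w"
      "J (cinv M i (x z)) (r *\<^sub>R v) = r *\<^sub>R J (cinv M i (x z)) v"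
    if "v \<in> tangent_space M (cinv M i (x z))" "w \<in> tangent_space M (cinv M i (x z))" for v w r
    using J that chart_at_topspace[OF c] unfolding smooth_endomorphism_def by blast+
  have Ji: "J (cinv M i (x z)) (v + w) i = J (cinv M i (x z)) v i + J (cinv M i (x z)) w i"
      "J (cinv M i (x z)) (r *\<^sub>R v) i = r *\<^sub>R J (cinv M i (x z)) v i"
    if "v \<in> tangent_space M (cinv M i (x z))" "w \<in> tangent_space M (cinv M i (x z))" for v w r
    using J'[OF that] by (simp_all add: scaleR_fun_def)
  show "linear (\<lambda>a. J (cinv M i (x z)) (coord_vec M i a (cinv M i (x z))) i)"
    by (rule linearI)
      (simp_all only: linear_add[OF linear_coord_vec[OF c]] linear_scale[OF linear_coord_vec[OF c]]
        Ji[OF T T])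
qed (use x A in auto)

lemma smooth_endomorphism_comp:
  assumes J: "smooth_endomorphism M J" and K: "smooth_endomorphism M K"
  shows "smooth_endomorphism M (\<lambda>p. J p \<circ> K p)"
  unfolding smooth_endomorphism_def
proof (intro conjI ballI)
  fix p v assume "p \<in> topspace (mtop M)" "v \<in> tangent_space M p"
  then show "(J p \<circ> K p) v \<in> tangent_space M p" "\<forall>r. (J p \<circ> K p) (r *\<^sub>R v) = r *\<^sub>R (J p \<circ> K p) v"
    using J K unfolding smooth_endomorphism_def by (auto simp del: plus_fun_apply)
  fix w assume "w \<in> tangent_space M p"
  with \<open>p \<in> _\<close> \<open>v \<in> _\<close> show "(J p \<circ> K p) (v + w) = (J p \<circ> K p) v + (J p \<circ> K p) w"
    using J K unfolding smooth_endomorphism_def by (auto simp del: plus_fun_apply)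
next
  fix i and a :: 'e assume i: "i \<in> charts M" and a: "a \<in> Basis"
  let ?S = "cmap M i ` cdom M i"
  show "smooth_on ?S (\<lambda>x. (J (cinv M i x) \<circ> K (cinv M i x)) (coord_vec M i a (cinv M i x)) i)"
  proof (rule smooth_on_cong[OF open_cmap_cdom[OF i]])
    show "smooth_on ?S (\<lambda>x. J (cinv M i x)
        (coord_vec M i (K (cinv M i x) (coord_vec M i a (cinv M i x)) i) (cinv M i x)) i)"
      using K i a unfolding smooth_endomorphism_def
      by (intro smooth_endomorphism_at[OF J i] open_cmap_cdom smooth_on_ident) auto
    fix x assume "x \<in> ?S"
    then have c: "chart_at M i (cinv M i x)" using i by (auto simp: chart_at_def)
    have "K (cinv M i x) (coord_vec M i a (cinv M i x)) \<in> tangent_space M (cinv M i x)"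
      using K[unfolded smooth_endomorphism_def] chart_at_topspace[OF c] coord_vec_tangent[OF c, of a] by simp
    from tangent_eq_coord_vec[OF this c]
    show "J (cinv M i x) (coord_vec M i (K (cinv M i x) (coord_vec M i a (cinv M i x)) i) (cinv M i x)) i
      = (J (cinv M i x) \<circ> K (cinv M i x)) (coord_vec M i a (cinv M i x)) i"
      by simp
  qed
qed

lemma metric_rules:
  assumes "pseudo_riemannian M g r s" "p \<in> topspace (mtop M)"
    "u \<in> tangent_space M p" "v \<in> tangent_space M p"
  shows "g p u v = g p v u" "g p (c *\<^sub>R u) v = c * g p u v"
    "w \<in> tangent_space M p \<Longrightarrow> g p (u + w) v = g p u v + g p w v"
  using assms unfolding pseudo_riemannian_def by blast+

lemma metric_zero:
  assumes "pseudo_riemannian M g r s" "p \<in> topspace (mtop M)" "v \<in> tangent_space M p"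
  shows "g p 0 v = 0" "g p v 0 = 0"
  using metric_rules(2)[OF assms(1,2) subspace_0[OF subspace_tangent_space] assms(3), of 0]
    metric_rules(1)[OF assms(1,2) subspace_0[OF subspace_tangent_space] assms(3)] by simp_all

lemma metric_minus:
  assumes "pseudo_riemannian M g r s" "p \<in> topspace (mtop M)"
    "u \<in> tangent_space M p" "v \<in> tangent_space M p"
  shows "g p (- u) (- v) = g p u v"
proof -
  have m: "g p (- a) b = - g p a b" if "a \<in> tangent_space M p" "b \<in> tangent_space M p" for a b
    using metric_rules(2)[OF assms(1,2) that, of "-1"] by simp
  have "- u \<in> tangent_space M p" "- v \<in> tangent_space M p"
    using assms subspace_neg[OF subspace_tangent_space] by blast+
  then have "g p (- u) (- v) = - g p u (- v)" "g p u (- v) = g p (- v) u"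
      "g p (- v) u = - g p v u" "g p v u = g p u v"
    using m assms(3,4) metric_rules(1)[OF assms(1,2)] by blast+
  then show ?thesis by simp
qed

lemma smooth_metric_at:
  fixes x :: "'g::euclidean_space \<Rightarrow> 'e"
  assumes g: "pseudo_riemannian M g r s"
    and x: "i \<in> charts M" "open S" "smooth_on S x" "x ` S \<subseteq> cmap M i ` cdom M i"
    and A: "smooth_on S A" and B: "smooth_on S B"
  shows "smooth_on S (\<lambda>z. g (cinv M i (x z)) (coord_vec M i (A z) (cinv M i (x z)))
    (coord_vec M i (B z) (cinv M i (x z))))"
proof -
  let ?g = "\<lambda>z a b. g (cinv M i (x z)) (coord_vec M i a (cinv M i (x z))) (coord_vec M i b (cinv M i (x z)))"
  have c: "chart_at M i (cinv M i (x z))" if "z \<in> S" for z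
    using x(1,4) that by (auto simp: chart_at_def)
  note rules = metric_rules[OF g chart_at_topspace[OF c] coord_vec_tangent[OF c] coord_vec_tangent[OF c]]
  have left: "linear (\<lambda>a. ?g z a b)" if "z \<in> S" for z b
    by (rule linearI)
      (simp_all only: linear_add[OF linear_coord_vec[OF c[OF that]]] linear_scale[OF linear_coord_vec[OF c[OF that]]]
        rules(2)[OF that that that] rules(3)[OF that that that coord_vec_tangent[OF c[OF that]]] real_scaleR_def)
  have right: "linear (?g z a)" if "z \<in> S" for z a
    using left[OF that, of a] by (simp only: rules(1)[OF that that that, of a])
  have base: "smooth_on S (\<lambda>z. ?g z a b)" if "a \<in> Basis" "b \<in> Basis" for a b
    by (rule smooth_at_base[OF x g[unfolded pseudo_riemannian_def, THEN conjunct2, rule_format, OF x(1) that]])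
  have half: "smooth_on S (\<lambda>z. ?g z (A z) b)" if "b \<in> Basis" for b
    by (rule smooth_on_linear_combination[where L = "\<lambda>z a. ?g z a b"]) (use x A base that left in auto)
  show ?thesis
    by (rule smooth_on_linear_combination[where L = "\<lambda>z b. ?g z (A z) b"]) (use x B half right in auto)
qed

end

context torsion_free_connection
begin

lemma smooth_Gam_at:
  fixes x :: "'g::euclidean_space \<Rightarrow> 'e"
  assumes x: "i \<in> charts M" "open S" "smooth_on S x" "x ` S \<subseteq> cmap M i ` cdom M i"
    and A: "smooth_on S A" and B: "smooth_on S B"
  shows "smooth_on S (\<lambda>z. Gam i (cinv M i (x z)) (A z) (B z))"
proof -
  have c: "chart_at M i (cinv M i (x z))" if "z \<in> S" for z
    using x(1,4) that by (auto simp: chart_at_def)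
  have base: "smooth_on S (\<lambda>z. Gam i (cinv M i (x z)) a b)" for a b
    by (rule smooth_at_base[OF x smooth_Gam[OF x(1)]])
  have half: "smooth_on S (\<lambda>z. Gam i (cinv M i (x z)) (A z) b)" for b
    by (rule smooth_on_linear_combination[where L = "\<lambda>z a. Gam i (cinv M i (x z)) a b"])
      (use x A base linear_Gam_left[OF c] in auto)
  show ?thesis
    by (rule smooth_on_linear_combination[where L = "\<lambda>z b. Gam i (cinv M i (x z)) (A z) b"])
      (use x B half linear_Gam_right[OF c] in auto)
qed

lemma TM_coord_vec:
  assumes "chart_at TM i u"
  shows "coord_vec TM i a u = lift u (coord_vec M i (fst a) (fst u))
    (coord_vec M i (snd a + Gam i (fst u) (snd u i) (fst a)) (fst u))"
  using lift_in_chart[OF assms TM.coord_vec_tangent[OF assms]] by (simp only: TM.coord_vec_self[OF assms])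

lemma TM_chart_image: "i \<in> charts M \<Longrightarrow> cmap TM i ` cdom TM i = cmap M i ` cdom M i \<times> UNIV"
  using TM_overlap[of i i] by simp

lemma TM_open_chart_image: "i \<in> charts M \<Longrightarrow> open (cmap TM i ` cdom TM i)"
  by (simp add: TM_chart_image open_Times open_cmap_cdom)

lemma TM_cinv_image:
  assumes "i \<in> charts M" "z \<in> cmap TM i ` cdom TM i"
  shows "fst (cinv TM i z) = cinv M i (fst z)" "snd (cinv TM i z) i = snd z"
    "chart_at TM i (cinv TM i z)" "chart_at M i (cinv M i (fst z))"
    "cinv TM i z \<in> topspace (mtop TM)"
proof -
  obtain p where p: "fst z = cmap M i p" "p \<in> cdom M i"
    using assms by (auto simp: TM_chart_image)
  then have "z = (cmap M i p, snd z)" by (simp add: prod_eq_iff)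
  then have "cinv TM i z = (p, coord_vec M i (snd z) p)"
    using TM_cinv[OF assms(1) p(2)] by metis
  moreover have "chart_at M i p" using p assms(1) by (simp add: chart_at_def)
  ultimately show "fst (cinv TM i z) = cinv M i (fst z)" "snd (cinv TM i z) i = snd z"
    and *: "chart_at TM i (cinv TM i z)" "chart_at M i (cinv M i (fst z))"
    using p assms(1) by (simp_all add: TM_chart_at coord_vec_self coord_vec_tangent)
  show "cinv TM i z \<in> topspace (mtop TM)"
    by (rule TM.chart_at_topspace[OF *(1)])
qed

lemma smooth_TM_base:
  assumes "i \<in> charts M"
  shows "open (cmap TM i ` cdom TM i)" "smooth_on (cmap TM i ` cdom TM i) fst"
    "fst ` (cmap TM i ` cdom TM i) \<subseteq> cmap M i ` cdom M i"
  using TM_open_chart_image[OF assms] smooth_on_fst[OF _ smooth_on_ident]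
  by (auto simp: TM_chart_image[OF assms])

text \<open>The vertical part of the coordinate vector field of the bundle with components \<open>a\<close>.\<close>

lemma smooth_vertical_part:
  assumes "i \<in> charts M"
  shows "smooth_on (cmap TM i ` cdom TM i) (\<lambda>z. snd a + Gam i (cinv M i (fst z)) (snd z) (fst a))"
  using assms TM_open_chart_image[OF assms]
  by (intro smooth_on_add smooth_on_const smooth_Gam_at smooth_TM_base smooth_on_snd smooth_on_ident)

text \<open>A field \<open>K\<close> along the bundle is given by its horizontal and vertical parts \<open>V\<close> and \<open>W\<close>, which may be
  chosen pointwise; only their components \<open>X\<close> and \<open>Y\<close> in one chart have to depend smoothly on the point.\<close>

lemma smooth_lift:
  assumes "i \<in> charts M"
    and "smooth_on (cmap TM i ` cdom TM i) X" "smooth_on (cmap TM i ` cdom TM i) Y"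
    and "\<And>z. z \<in> cmap TM i ` cdom TM i \<Longrightarrow> \<exists>V W. K z = lift (cinv TM i z) V W \<and> V i = X z \<and> W i = Y z"
  shows "smooth_on (cmap TM i ` cdom TM i) (\<lambda>z. K z i)"
proof (rule smooth_on_cong)
  let ?S = "cmap TM i ` cdom TM i"
  show op: "open ?S" by (rule TM_open_chart_image[OF assms(1)])
  show "smooth_on ?S (\<lambda>z. (X z, Y z + - Gam i (cinv M i (fst z)) (snd z) (X z)))"
    by (intro smooth_on_Pair smooth_on_add smooth_on_minus smooth_Gam_at smooth_TM_base smooth_on_snd
        smooth_on_ident op assms)
  show "(X z, Y z + - Gam i (cinv M i (fst z)) (snd z) (X z)) = K z i" if "z \<in> ?S" for z
    using assms(4)[OF that] TM_cinv_image[OF assms(1) that] by (auto simp: lift_apply)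
qed

lemma smooth_endomorphism_J1: "smooth_endomorphism TM (lift_J1 M nab)"
  unfolding smooth_endomorphism_def
proof (intro conjI ballI allI)
  fix u \<xi> assume u: "u \<in> topspace (mtop TM)" and "\<xi> \<in> tangent_space TM u"
  then obtain X Y where X: "X \<in> tangent_space M (fst u)" "Y \<in> tangent_space M (fst u)" "\<xi> = lift u X Y"
    using lift_cases by blast
  have neg: "- Y \<in> tangent_space M (fst u)"
    using X(2) subspace_neg[OF subspace_tangent_space] by blast
  show "lift_J1 M nab u \<xi> \<in> tangent_space TM u"
    using lift_tangent[OF u neg X(1)] by (simp add: X(3) lift_J1_lift[OF u X(1,2)])
  show "lift_J1 M nab u (r *\<^sub>R \<xi>) = r *\<^sub>R lift_J1 M nab u \<xi>" for r
    using X(1,2) by (simp add: X(3) lift_scale lift_J1_lift u subspace_scale[OF subspace_tangent_space])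
  fix \<eta> assume "\<eta> \<in> tangent_space TM u"
  then obtain X' Y' where X': "X' \<in> tangent_space M (fst u)" "Y' \<in> tangent_space M (fst u)" "\<eta> = lift u X' Y'"
    using lift_cases u by blast
  show "lift_J1 M nab u (\<xi> + \<eta>) = lift_J1 M nab u \<xi> + lift_J1 M nab u \<eta>"
    using X(1,2) X'(1,2)
    by (simp add: X(3) X'(3) lift_add lift_J1_lift u subspace_add[OF subspace_tangent_space])
next
  fix i and a :: "'e \<times> 'e" assume "i \<in> charts TM"
  then have i: "i \<in> charts M" by (simp add: TM_simps)
  show "smooth_on (cmap TM i ` cdom TM i)
      (\<lambda>z. lift_J1 M nab (cinv TM i z) (coord_vec TM i a (cinv TM i z)) i)"
  proof (rule smooth_lift[OF i smooth_on_minus[OF TM_open_chart_image[OF i] smooth_vertical_part[OF i, of a]]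
        smooth_on_const[of _ "fst a"],
        where K = "\<lambda>z. lift_J1 M nab (cinv TM i z) (coord_vec TM i a (cinv TM i z))"])
    fix z assume z: "z \<in> cmap TM i ` cdom TM i"
    note u = TM_cinv_image[OF i z]
    let ?V = "snd a + Gam i (cinv M i (fst z)) (snd z) (fst a)"
    have "lift_J1 M nab (cinv TM i z) (coord_vec TM i a (cinv TM i z)) =
      lift (cinv TM i z) (- coord_vec M i ?V (cinv M i (fst z))) (coord_vec M i (fst a) (cinv M i (fst z)))"
      by (simp add: TM_coord_vec[OF u(3)] lift_J1_lift u coord_vec_tangent)
    then show "\<exists>V W. lift_J1 M nab (cinv TM i z) (coord_vec TM i a (cinv TM i z)) = lift (cinv TM i z) V W \<and>
        V i = - ?V \<and> W i = fst a"
      by (intro exI conjI) (assumption, simp_all add: coord_vec_self u)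
  qed
qed

lemma smooth_endomorphism_J2:
  assumes J: "smooth_endomorphism M J"
  shows "smooth_endomorphism TM (lift_J2 M nab J)"
proof -
  have J': "J p v \<in> tangent_space M p" "J p (r *\<^sub>R v) = r *\<^sub>R J p v"
      "w \<in> tangent_space M p \<Longrightarrow> J p (v + w) = J p v + J p w"
    if "p \<in> topspace (mtop M)" "v \<in> tangent_space M p" for p v w r
    using J that unfolding smooth_endomorphism_def by blast+
  show ?thesis
    unfolding smooth_endomorphism_def
  proof (intro conjI ballI allI)
    fix u \<xi> assume u: "u \<in> topspace (mtop TM)" and "\<xi> \<in> tangent_space TM u"
    then obtain X Y where X: "X \<in> tangent_space M (fst u)" "Y \<in> tangent_space M (fst u)" "\<xi> = lift u X Y"
      using lift_cases by blast
    have p: "fst u \<in> topspace (mtop M)" using u by (auto simp: TM_topspace)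
    show "lift_J2 M nab J u \<xi> \<in> tangent_space TM u"
      using lift_tangent[OF u J'(1)[OF p X(2)] J'(1)[OF p X(1)]] by (simp add: X(3) lift_J2_lift[OF u X(1,2)])
    show "lift_J2 M nab J u (r *\<^sub>R \<xi>) = r *\<^sub>R lift_J2 M nab J u \<xi>" for r
      using X(1,2)
      by (simp add: X(3) lift_scale lift_J2_lift u subspace_scale[OF subspace_tangent_space] J'(2) p)
    fix \<eta> assume "\<eta> \<in> tangent_space TM u"
    then obtain X' Y' where X': "X' \<in> tangent_space M (fst u)" "Y' \<in> tangent_space M (fst u)" "\<eta> = lift u X' Y'"
      using lift_cases u by blast
    show "lift_J2 M nab J u (\<xi> + \<eta>) = lift_J2 M nab J u \<xi> + lift_J2 M nab J u \<eta>"
      using X(1,2) X'(1,2)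
      by (simp add: X(3) X'(3) lift_add lift_J2_lift u subspace_add[OF subspace_tangent_space] J'(3) p)
  next
    fix i and a :: "'e \<times> 'e" assume "i \<in> charts TM"
    then have i: "i \<in> charts M" by (simp add: TM_simps)
    let ?V = "\<lambda>z. snd a + Gam i (cinv M i (fst z)) (snd z) (fst a)"
    let ?J = "\<lambda>z v. J (cinv M i (fst z)) (coord_vec M i v (cinv M i (fst z))) i"
    show "smooth_on (cmap TM i ` cdom TM i)
        (\<lambda>z. lift_J2 M nab J (cinv TM i z) (coord_vec TM i a (cinv TM i z)) i)"
    proof (rule smooth_lift[OF i, where X = "\<lambda>z. ?J z (?V z)" and Y = "\<lambda>z. ?J z (fst a)" and
          K = "\<lambda>z. lift_J2 M nab J (cinv TM i z) (coord_vec TM i a (cinv TM i z))"])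
      show "smooth_on (cmap TM i ` cdom TM i) (\<lambda>z. ?J z (?V z))"
        by (rule smooth_endomorphism_at[OF J i smooth_TM_base[OF i] smooth_vertical_part[OF i]])
      show "smooth_on (cmap TM i ` cdom TM i) (\<lambda>z. ?J z (fst a))"
        by (rule smooth_endomorphism_at[OF J i smooth_TM_base[OF i] smooth_on_const])
      fix z assume z: "z \<in> cmap TM i ` cdom TM i"
      note u = TM_cinv_image[OF i z]
      have "lift_J2 M nab J (cinv TM i z) (coord_vec TM i a (cinv TM i z)) =
        lift (cinv TM i z) (J (cinv M i (fst z)) (coord_vec M i (?V z) (cinv M i (fst z))))
          (J (cinv M i (fst z)) (coord_vec M i (fst a) (cinv M i (fst z))))"
        by (simp add: TM_coord_vec[OF u(3)] lift_J2_lift u coord_vec_tangent)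
      then show "\<exists>V W. lift_J2 M nab J (cinv TM i z) (coord_vec TM i a (cinv TM i z)) = lift (cinv TM i z) V W \<and>
          V i = ?J z (?V z) \<and> W i = ?J z (fst a)"
        by blast
    qed
  qed
qed

end

section \<open>The Sasaki metric\<close>

lemma bilinear_sum_left:
  assumes V: "subspace V" "finite A" "A \<subseteq> V" "w \<in> V"
    and add: "\<And>u v. u \<in> V \<Longrightarrow> v \<in> V \<Longrightarrow> b (u + v) w = b u w + b v w"
    and scale: "\<And>c u. u \<in> V \<Longrightarrow> b (c *\<^sub>R u) w = c * b u w"
  shows "b (\<Sum>v\<in>A. f v *\<^sub>R v) w = (\<Sum>v\<in>A. f v * b v w :: real)"
  using V(2,3)
proof (induction A rule: finite_induct)
  case empty
  show ?case using scale[OF subspace_0[OF V(1)], of 0] by simp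
next
  case (insert a A)
  have "f a *\<^sub>R a \<in> V" "(\<Sum>v\<in>A. f v *\<^sub>R v) \<in> V"
    using insert.prems by (auto intro!: subspace_scale subspace_sum V(1))
  then show ?case using insert add scale by simp
qed

text \<open>Orthogonal vectors with non-zero squares are independent, and the sign of the square
  tells the vectors of \<open>P\<close> from those of \<open>N\<close>; so an orthogonal spanning set is enough.\<close>

lemma has_signatureI:
  assumes V: "subspace V" "span (P \<union> N) = V"
    and add: "\<And>u v w. u \<in> V \<Longrightarrow> v \<in> V \<Longrightarrow> w \<in> V \<Longrightarrow> b (u + v) w = b u w + b v w"
    and scale: "\<And>c u w. u \<in> V \<Longrightarrow> w \<in> V \<Longrightarrow> b (c *\<^sub>R u) w = c * b u w"
    and PN: "finite P" "finite N" "card P = p" "card N = q"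
    and orth: "\<And>v w. v \<in> P \<union> N \<Longrightarrow> w \<in> P \<union> N \<Longrightarrow> v \<noteq> w \<Longrightarrow> b v w = 0"
    and pos: "\<And>v. v \<in> P \<Longrightarrow> b v v > 0" and neg: "\<And>v. v \<in> N \<Longrightarrow> b v v < 0"
  shows "has_signature V b p q"
  unfolding has_signature_def
proof (intro exI conjI)
  have False if "v \<in> P" "v \<in> N" for v
    using pos[OF that(1)] neg[OF that(2)] by simp
  then show "P \<inter> N = {}" by blast
  have PV: "P \<union> N \<subseteq> V" using V(2) span_superset by blast
  show "independent (P \<union> N)"
  proof (rule independent_if_scalars_zero)
    fix f v assume 0: "(\<Sum>x\<in>P \<union> N. f x *\<^sub>R x) = 0" and v: "v \<in> P \<union> N"
    have "0 = b (0 *\<^sub>R 0) v"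
      using scale[of 0 v 0] v PV subspace_0[OF V(1)] by auto
    also have "\<dots> = b (\<Sum>x\<in>P \<union> N. f x *\<^sub>R x) v" by (simp add: 0)
    also have "\<dots> = (\<Sum>x\<in>P \<union> N. f x * b x v)"
      using v PV PN by (intro bilinear_sum_left[OF V(1)] add scale) auto
    also have "\<dots> = (\<Sum>x\<in>P \<union> N. if x = v then f v * b v v else 0)"
      using orth v by (intro sum.cong) auto
    also have "\<dots> = f v * b v v" using v PN by (simp add: sum.delta)
    finally show "f v = 0" using v pos[of v] neg[of v] by auto
  qed (use PN in simp)
qed (use assms in auto)

context torsion_free_connection
begin

lemma sasaki_rules:
  assumes g: "pseudo_riemannian M g r s" and u: "u \<in> topspace (mtop TM)"
    and "\<xi> \<in> tangent_space TM u" "\<eta> \<in> tangent_space TM u"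
  shows "sasaki M nab g u \<xi> \<eta> = sasaki M nab g u \<eta> \<xi>"
    and "sasaki M nab g u (c *\<^sub>R \<xi>) \<eta> = c * sasaki M nab g u \<xi> \<eta>"
    and "\<zeta> \<in> tangent_space TM u \<Longrightarrow>
      sasaki M nab g u (\<xi> + \<zeta>) \<eta> = sasaki M nab g u \<xi> \<eta> + sasaki M nab g u \<zeta> \<eta>"
proof -
  have p: "fst u \<in> topspace (mtop M)" using u by (auto simp: TM_topspace)
  note rules = metric_rules[OF g p]
  obtain X Y where X: "X \<in> tangent_space M (fst u)" "Y \<in> tangent_space M (fst u)" "\<xi> = lift u X Y"
    using lift_cases[OF u assms(3)] .
  obtain X' Y' where X': "X' \<in> tangent_space M (fst u)" "Y' \<in> tangent_space M (fst u)" "\<eta> = lift u X' Y'"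
    using lift_cases[OF u assms(4)] .
  note sl = sasaki_lift[OF u, of _ _ _ _ g]
  show "sasaki M nab g u \<xi> \<eta> = sasaki M nab g u \<eta> \<xi>"
    using rules(1) X(1,2) X'(1,2) by (simp add: X(3) X'(3) sl)
  show "sasaki M nab g u (c *\<^sub>R \<xi>) \<eta> = c * sasaki M nab g u \<xi> \<eta>"
    using X(1,2) X'(1,2)
    by (simp add: X(3) X'(3) lift_scale sl subspace_scale[OF subspace_tangent_space] rules(2) distrib_left)
  assume "\<zeta> \<in> tangent_space TM u"
  then obtain V W where V: "V \<in> tangent_space M (fst u)" "W \<in> tangent_space M (fst u)" "\<zeta> = lift u V W"
    using lift_cases[OF u] by blast
  show "sasaki M nab g u (\<xi> + \<zeta>) \<eta> = sasaki M nab g u \<xi> \<eta> + sasaki M nab g u \<zeta> \<eta>"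
    using X(1,2) X'(1,2) V(1,2)
    by (simp add: X(3) X'(3) V(3) lift_add sl subspace_add[OF subspace_tangent_space] rules(3))
qed

text \<open>The horizontal and the vertical lifts of an orthogonal basis at the base point together form an
  orthogonal basis; each vector is lifted twice with the same square, which doubles both indices.\<close>

lemma sasaki_signature:
  assumes g: "pseudo_riemannian M g r s" and u: "u \<in> topspace (mtop TM)"
  shows "has_signature (tangent_space TM u) (sasaki M nab g u) (2 * r) (2 * s)"
proof -
  let ?p = "fst u" and ?h = "hlift M nab u" and ?v = "vlift u"
  have p: "?p \<in> topspace (mtop M)" using u by (auto simp: TM_topspace)
  have "has_signature (tangent_space M ?p) (g ?p) r s"
    using g p by (simp add: pseudo_riemannian_def)
  then obtain P N where PN: "finite P" "finite N" "card P = r" "card N = s"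
      "span (P \<union> N) = tangent_space M ?p"
    and orth: "\<forall>v\<in>P \<union> N. \<forall>w\<in>P \<union> N. v \<noteq> w \<longrightarrow> g ?p v w = 0"
    and pos: "\<forall>v\<in>P. g ?p v v > 0" and neg: "\<forall>v\<in>N. g ?p v v < 0"
    unfolding has_signature_def by (elim exE conjE) (rule that; assumption)
  have T: "X \<in> tangent_space M ?p" if "X \<in> P \<union> N" for X
    using span_base[OF that] PN(5) by simp
  have zero: "0 \<in> tangent_space M ?p" by (rule subspace_0[OF subspace_tangent_space])
  have hv: "?h X = lift u X 0" "?v X = lift u 0 X" for X
    using linear_0[OF linear_hlift] linear_0[OF linear_vlift] by (simp_all add: lift_def)
  have gh: "sasaki M nab g u (?h X) (?h X') = g ?p X X'" "sasaki M nab g u (?v X) (?v X') = g ?p X X'"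
    "sasaki M nab g u (?h X) (?v X') = 0" "sasaki M nab g u (?v X) (?h X') = 0"
    if "X \<in> P \<union> N" "X' \<in> P \<union> N" for X X'
    using that[THEN T] zero by (simp_all add: hv sasaki_lift[OF u] metric_zero[OF g p])
  have inj: "inj_on ?h (tangent_space M ?p)" "inj_on ?v (tangent_space M ?p)"
    using lift_inject[OF u] zero unfolding hv by (blast intro: inj_onI)+
  have disj: "?h X \<noteq> ?v Y" if "X \<in> P \<union> N" "Y \<in> P \<union> N" for X Y
  proof
    assume "?h X = ?v Y"
    then have "X = 0" using lift_inject[OF u T[OF that(1)] zero zero T[OF that(2)]] by (simp add: hv)
    then show False using that(1) pos neg metric_zero[OF g p zero] by fastforce
  qed
  have card: "card (?h ` A \<union> ?v ` A) = 2 * card A" if "A \<subseteq> P \<union> N" for A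
  proof -
    have "finite A" using that PN finite_subset by blast
    moreover have "?h ` A \<inter> ?v ` A = {}" using that disj by blast
    moreover have "A \<subseteq> tangent_space M ?p" using that T by blast
    ultimately show ?thesis
      using inj by (simp add: card_Un_disjoint card_image inj_on_subset)
  qed
  have span: "span ((?h ` P \<union> ?v ` P) \<union> (?h ` N \<union> ?v ` N)) = tangent_space TM u"
  proof -
    have "(?h ` P \<union> ?v ` P) \<union> (?h ` N \<union> ?v ` N) = ?h ` (P \<union> N) \<union> ?v ` (P \<union> N)" by blast
    then have "span ((?h ` P \<union> ?v ` P) \<union> (?h ` N \<union> ?v ` N))
        = {x + y |x y. x \<in> ?h ` tangent_space M ?p \<and> y \<in> ?v ` tangent_space M ?p}"
      by (simp only: span_Un[of "?h ` (P \<union> N)"] linear_span_image[OF linear_hlift] linear_span_image[OF linear_vlift] PN(5))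
    also have "\<dots> = {lift u X Y |X Y. X \<in> tangent_space M ?p \<and> Y \<in> tangent_space M ?p}"
      unfolding lift_def by blast
    also have "\<dots> = tangent_space TM u"
      using lift_tangent[OF u] lift_cases[OF u] by blast
    finally show ?thesis .
  qed
  show ?thesis
  proof (rule has_signatureI[OF TM.subspace_tangent_space span])
    show "card (?h ` P \<union> ?v ` P) = 2 * r" "card (?h ` N \<union> ?v ` N) = 2 * s"
      using card[of P] card[of N] PN by simp_all
    show "sasaki M nab g u v w = 0"
      if v: "v \<in> (?h ` P \<union> ?v ` P) \<union> (?h ` N \<union> ?v ` N)"
        and w: "w \<in> (?h ` P \<union> ?v ` P) \<union> (?h ` N \<union> ?v ` N)" and "v \<noteq> w" for v w
    proof -
      obtain X where X: "X \<in> P \<union> N" "v = ?h X \<or> v = ?v X" using v by blast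
      obtain Y where Y: "Y \<in> P \<union> N" "w = ?h Y \<or> w = ?v Y" using w by blast
      show ?thesis
        using gh[OF X(1) Y(1)] X Y \<open>v \<noteq> w\<close> orth by metis
    qed
    show "sasaki M nab g u v v > 0" if "v \<in> ?h ` P \<union> ?v ` P" for v
      using that gh(1,2) pos by auto
    show "sasaki M nab g u v v < 0" if "v \<in> ?h ` N \<union> ?v ` N" for v
      using that gh(1,2) neg by auto
  qed (use PN sasaki_rules[OF g u] in auto)
qed

lemma smooth_sasaki:
  assumes g: "pseudo_riemannian M g r s" and i: "i \<in> charts M"
  shows "smooth_on (cmap TM i ` cdom TM i)
    (\<lambda>z. sasaki M nab g (cinv TM i z) (coord_vec TM i a (cinv TM i z)) (coord_vec TM i b (cinv TM i z)))"
proof (rule smooth_on_cong)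
  let ?S = "cmap TM i ` cdom TM i"
  let ?V = "\<lambda>c z. snd c + Gam i (cinv M i (fst z)) (snd z) (fst c)"
  let ?g = "\<lambda>z v w. g (cinv M i (fst z)) (coord_vec M i v (cinv M i (fst z))) (coord_vec M i w (cinv M i (fst z)))"
  show op: "open ?S" by (rule TM_open_chart_image[OF i])
  have "smooth_on ?S (\<lambda>z. ?g z (fst a) (fst b))"
    by (rule smooth_metric_at[OF g i smooth_TM_base[OF i] smooth_on_const smooth_on_const])
  moreover have "smooth_on ?S (\<lambda>z. ?g z (?V a z) (?V b z))"
    by (rule smooth_metric_at[OF g i smooth_TM_base[OF i] smooth_vertical_part[OF i] smooth_vertical_part[OF i]])
  ultimately show "smooth_on ?S (\<lambda>z. ?g z (fst a) (fst b) + ?g z (?V a z) (?V b z))"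
    by (rule smooth_on_add[OF op])
  fix z assume "z \<in> ?S"
  note u = TM_cinv_image[OF i this]
  show "?g z (fst a) (fst b) + ?g z (?V a z) (?V b z) =
      sasaki M nab g (cinv TM i z) (coord_vec TM i a (cinv TM i z)) (coord_vec TM i b (cinv TM i z))"
    by (simp add: TM_coord_vec[OF u(3)] sasaki_lift u coord_vec_tangent)
qed

lemma sasaki_pseudo_riemannian:
  assumes g: "pseudo_riemannian M g r s"
  shows "pseudo_riemannian TM (sasaki M nab g) (2 * r) (2 * s)"
  unfolding pseudo_riemannian_def
proof (intro conjI ballI allI impI)
  fix u \<xi> assume u: "u \<in> topspace (mtop TM)" and "\<xi> \<in> tangent_space TM u"
    and null: "\<forall>\<eta>\<in>tangent_space TM u. sasaki M nab g u \<xi> \<eta> = 0"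
  then obtain X Y where X: "X \<in> tangent_space M (fst u)" "Y \<in> tangent_space M (fst u)" "\<xi> = lift u X Y"
    using lift_cases by blast
  have p: "fst u \<in> topspace (mtop M)" using u by (auto simp: TM_topspace)
  have zero: "0 \<in> tangent_space M (fst u)" by (rule subspace_0[OF subspace_tangent_space])
  have "g (fst u) X V = 0" "g (fst u) Y V = 0" if "V \<in> tangent_space M (fst u)" for V
    using null lift_tangent[OF u that zero] lift_tangent[OF u zero that] X that zero
    by (force simp: sasaki_lift[OF u] metric_zero[OF g p])+
  then have "X = 0" "Y = 0"
    using g p X(1,2) unfolding pseudo_riemannian_def by blast+
  then show "\<xi> = 0" using lift_scale[of 0 u 0 0] X(3) by simp
next
  fix i and a b :: "'e \<times> 'e" assume "i \<in> charts TM"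
  then show "smooth_on (cmap TM i ` cdom TM i)
    (\<lambda>z. sasaki M nab g (cinv TM i z) (coord_vec TM i a (cinv TM i z)) (coord_vec TM i b (cinv TM i z)))"
    using smooth_sasaki[OF g] by (simp add: TM_simps)
qed (use sasaki_rules[OF g] sasaki_signature[OF g] in blast)+

end

section \<open>The almost hypercomplex structure\<close>

context torsion_free_connection
begin

lemma almost_complex_rules:
  assumes "almost_complex M J" "p \<in> topspace (mtop M)" "v \<in> tangent_space M p"
  shows "J p v \<in> tangent_space M p" "J p (J p v) = - v" "J p (- v) = - J p v"
proof -
  have "J p ((-1) *\<^sub>R v) = (-1) *\<^sub>R J p v"
    using assms unfolding almost_complex_def smooth_endomorphism_def by blast
  then show "J p (- v) = - J p v" by simp
qed (use assms in \<open>auto simp: almost_complex_def smooth_endomorphism_def\<close>)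

text \<open>On pairs \<open>(X, Y)\<close> of tangent vectors of the base the three structures become matrices with entries
  \<open>\<plusminus>1\<close> and \<open>\<plusminus>J\<close>, and the quaternionic relations follow from \<open>J\<^sup>2 = -1\<close> alone.\<close>

lemma lifted_structures_lift:
  assumes J: "almost_complex M J" and u: "u \<in> topspace (mtop TM)"
    and X: "X \<in> tangent_space M (fst u)" "Y \<in> tangent_space M (fst u)"
  shows "lift_J1 M nab u (lift u X Y) = lift u (- Y) X"
    and "lift_J2 M nab J u (lift u X Y) = lift u (J (fst u) Y) (J (fst u) X)"
    and "lift_J3 M nab J u (lift u X Y) = lift u (- J (fst u) X) (J (fst u) Y)"
proof -
  have p: "fst u \<in> topspace (mtop M)" using u by (auto simp: TM_topspace)
  show "lift_J1 M nab u (lift u X Y) = lift u (- Y) X"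
    "lift_J2 M nab J u (lift u X Y) = lift u (J (fst u) Y) (J (fst u) X)"
    "lift_J3 M nab J u (lift u X Y) = lift u (- J (fst u) X) (J (fst u) Y)"
    using X by (simp_all add: lift_J1_lift lift_J2_lift lift_J3_def u almost_complex_rules[OF J p])
qed

lemma lifted_almost_hypercomplex:
  assumes J: "almost_complex M J"
  shows "almost_hypercomplex TM (lift_J1 M nab) (lift_J2 M nab J) (lift_J3 M nab J)"
proof -
  have "smooth_endomorphism M J" using J by (simp add: almost_complex_def)
  then have smooth: "smooth_endomorphism TM (lift_J1 M nab)" "smooth_endomorphism TM (lift_J2 M nab J)"
      "smooth_endomorphism TM (lift_J3 M nab J)"
    unfolding lift_J3_def
    by (intro smooth_endomorphism_J1 smooth_endomorphism_J2 TM.smooth_endomorphism_comp; assumption)+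
  have alg: "lift_J1 M nab u (lift_J1 M nab u \<xi>) = - \<xi> \<and> lift_J2 M nab J u (lift_J2 M nab J u \<xi>) = - \<xi> \<and>
      lift_J3 M nab J u (lift_J3 M nab J u \<xi>) = - \<xi> \<and>
      lift_J1 M nab u (lift_J2 M nab J u \<xi>) = - lift_J2 M nab J u (lift_J1 M nab u \<xi>) \<and>
      lift_J2 M nab J u (lift_J3 M nab J u \<xi>) = - lift_J3 M nab J u (lift_J2 M nab J u \<xi>) \<and>
      lift_J3 M nab J u (lift_J1 M nab u \<xi>) = - lift_J1 M nab u (lift_J3 M nab J u \<xi>) \<and>
      lift_J3 M nab J u \<xi> = lift_J1 M nab u (lift_J2 M nab J u \<xi>)"
    if u: "u \<in> topspace (mtop TM)" and \<xi>: "\<xi> \<in> tangent_space TM u" for u \<xi>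
  proof -
    obtain X Y where X: "X \<in> tangent_space M (fst u)" "Y \<in> tangent_space M (fst u)" "\<xi> = lift u X Y"
      using lift_cases[OF u \<xi>] .
    have p: "fst u \<in> topspace (mtop M)" using u by (auto simp: TM_topspace)
    show ?thesis
      using X(1,2)
      by (simp add: X(3) lifted_structures_lift[OF J u] lift_minus almost_complex_rules[OF J p]
          subspace_neg[OF subspace_tangent_space])
  qed
  show ?thesis
    unfolding almost_hypercomplex_def almost_complex_def
    using smooth alg by blast
qed

text \<open>On pairs \<open>(X, Y)\<close> the metric is \<open>g \<oplus> g\<close>. The first structure permutes the two slots up to sign and so
  preserves it; each of the other two applies \<open>J\<close> once in each slot and so reverses the sign.\<close>

lemma sasaki_lifted_structures:
  assumes J: "almost_complex M J" and g: "pseudo_riemannian M g r s"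
    and skew: "\<And>p u v. p \<in> topspace (mtop M) \<Longrightarrow> u \<in> tangent_space M p \<Longrightarrow> v \<in> tangent_space M p \<Longrightarrow>
      g p (J p u) (J p v) = - g p u v"
    and u: "u \<in> topspace (mtop TM)" and "\<xi> \<in> tangent_space TM u" "\<eta> \<in> tangent_space TM u"
  shows "sasaki M nab g u \<xi> \<eta> = sasaki M nab g u (lift_J1 M nab u \<xi>) (lift_J1 M nab u \<eta>)"
    and "sasaki M nab g u \<xi> \<eta> = - sasaki M nab g u (lift_J2 M nab J u \<xi>) (lift_J2 M nab J u \<eta>)"
    and "sasaki M nab g u \<xi> \<eta> = - sasaki M nab g u (lift_J3 M nab J u \<xi>) (lift_J3 M nab J u \<eta>)"
proof -
  have p: "fst u \<in> topspace (mtop M)" using u by (auto simp: TM_topspace)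
  obtain X Y where X: "X \<in> tangent_space M (fst u)" "Y \<in> tangent_space M (fst u)" "\<xi> = lift u X Y"
    using lift_cases[OF u assms(5)] .
  obtain X' Y' where X': "X' \<in> tangent_space M (fst u)" "Y' \<in> tangent_space M (fst u)" "\<eta> = lift u X' Y'"
    using lift_cases[OF u assms(6)] .
  show "sasaki M nab g u \<xi> \<eta> = sasaki M nab g u (lift_J1 M nab u \<xi>) (lift_J1 M nab u \<eta>)"
    "sasaki M nab g u \<xi> \<eta> = - sasaki M nab g u (lift_J2 M nab J u \<xi>) (lift_J2 M nab J u \<eta>)"
    "sasaki M nab g u \<xi> \<eta> = - sasaki M nab g u (lift_J3 M nab J u \<xi>) (lift_J3 M nab J u \<eta>)"
    using X(1,2) X'(1,2)
    by (simp_all add: X(3) X'(3) lifted_structures_lift[OF J u] sasaki_lift[OF u] skew[OF p]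
        metric_minus[OF g p] almost_complex_rules[OF J p] subspace_neg[OF subspace_tangent_space])
qed

end

theorem theorem3p6:
  fixes M :: "('a, 'i, 'e::euclidean_space) mfd"
    and n :: nat
    and J :: "'a \<Rightarrow> ('i \<Rightarrow> 'e) \<Rightarrow> 'i \<Rightarrow> 'e"
    and g g' :: "'a \<Rightarrow> ('i \<Rightarrow> 'e) \<Rightarrow> ('i \<Rightarrow> 'e) \<Rightarrow> real"
    and nab :: "'a set \<Rightarrow> ('a \<Rightarrow> 'i \<Rightarrow> 'e) \<Rightarrow> ('a \<Rightarrow> 'i \<Rightarrow> 'e) \<Rightarrow> 'a \<Rightarrow> 'i \<Rightarrow> 'e"
  defines "TM \<equiv> tangent_bundle M"
    and "J1 \<equiv> lift_J1 M nab"
    and "J2 \<equiv> lift_J2 M nab J"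
    and "J3 \<equiv> lift_J3 M nab J"
    and "gh \<equiv> sasaki M nab g"
  assumes "almost_skew_hermitian M n J g g'"
    and "levi_civita M g nab"
  shows "smooth_manifold TM (4 * n) \<and>
         almost_hypercomplex TM J1 J2 J3 \<and>
         pseudo_riemannian TM gh (2 * n) (2 * n) \<and>
         (\<forall>u\<in>topspace (mtop TM). \<forall>\<xi>\<in>tangent_space TM u. \<forall>\<eta>\<in>tangent_space TM u.
            gh u \<xi> \<eta> = gh u (J1 u \<xi>) (J1 u \<eta>) \<and>
            gh u \<xi> \<eta> = - gh u (J2 u \<xi>) (J2 u \<eta>) \<and>
            gh u \<xi> \<eta> = - gh u (J3 u \<xi>) (J3 u \<eta>))"
proof -
  have J: "almost_complex M J" and g: "pseudo_riemannian M g n n"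
    and skew: "\<And>p u v. p \<in> topspace (mtop M) \<Longrightarrow> u \<in> tangent_space M p \<Longrightarrow> v \<in> tangent_space M p \<Longrightarrow>
      g p (J p u) (J p v) = - g p u v"
    using assms(6) by (simp_all add: almost_skew_hermitian_def)
  interpret torsion_free_connection M "2 * n" nab
    using assms(6,7)
    by unfold_locales (simp_all add: almost_skew_hermitian_def levi_civita_def)
  show ?thesis
    unfolding TM_def J1_def J2_def J3_def gh_def
  proof (intro conjI ballI)
    show "smooth_manifold (tangent_bundle M) (4 * n)"
      using TM_smooth_manifold by simp
    show "almost_hypercomplex (tangent_bundle M) (lift_J1 M nab) (lift_J2 M nab J) (lift_J3 M nab J)"
      by (rule lifted_almost_hypercomplex[OF J])
    show "pseudo_riemannian (tangent_bundle M) (sasaki M nab g) (2 * n) (2 * n)"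
      by (rule sasaki_pseudo_riemannian[OF g])
  qed (rule sasaki_lifted_structures[OF J g]; use skew in blast)+
qed

end
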